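(* Let $\overline{\lambda}>0$ and $r>0$, and suppose the class of data distributions $\mathcal{P}$ satisfies the estimation-quality assumption (see context). Let the trade-off rule $\widehat{g}_{\text{tradeoff}}$ be a maximizer over $g\in\mathcal{G}$ of $\widehat{V}_n(g)=\widehat{W}_n(g)-\frac{\overline{\lambda}}{r}(\widehat{B}_n(g)-k)_+$. Then $\widehat{g}_{\text{tradeoff}}$ consistently achieves welfare weakly higher than $W(g_P^{\ast};P)$ for all $P\in\mathcal{P}$ and is uniformly asymptotically welfare-efficient over $\mathcal{P}$: for every $\epsilon>0$, $$\lim_{n\to\infty}\sup_{P\in\mathcal{P}}\Pr_{P^n}\left\{W(\widehat{g}_{\text{tradeoff}};P)-W(g_P^{\ast};P)<-\epsilon\right\}=0.$$ Moreover, with probability approaching one, uniformly over $P\in\mathcal{P}$, the violation of the budget constraint is bounded by $$(B(\widehat{g}_{\text{tradeoff}};P)-k)_+\le\frac{r\cdot\bigl(W(\widehat{g}_{\text{tradeoff}};P)-W(g_P^{\ast};P)\bigr)}{\overline{\lambda}}.$$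
   Context: $(x)_+=\max\{x,0\}$. $P$ is the joint distribution of $(\tau,C,X)$ with $X\in\mathcal{X}\subset\mathbb{R}^p$; $\mathcal{G}$ is a class of policies $g:\mathcal{X}\to\{0,1\}$; $k\in\mathbb{R}$ is a known budget threshold; $W(g;P)=\mathbb{E}_P[\tau g(X)]$, $B(g;P)=\mathbb{E}_P[C g(X)]$; $g_P^{\ast}$ is a solution (assumed to exist) of $\max_{g\in\mathcal{G}}W(g;P)$ subject to $B(g;P)\le k$. From a sample of size $n$ (with distribution $P^n$ induced by $P$) one has $X_i$ and individual estimates $(\tau_i^{\ast},C_i^{\ast})$, $i=1,\dots,n$, and sets $\widehat{W}_n(g)=\frac1n\sum_i\tau_i^{\ast}g(X_i)$, $\widehat{B}_n(g)=\frac1n\sum_i C_i^{\ast}g(X_i)$. Maximizers are assumed to exist. Estimation-quality assumption: as processes indexed by $g\in\mathcal{G}$, $\{\sqrt{n}(\widehat{W}_n(g)-W(g;P))\}_{g\in\mathcal{G}}\to_d G_P^W$ and $\{\sqrt{n}(\widehat{B}_n(g)-B(g;P))\}_{g\in\mathcal{G}}\to_d G_P^B$ (weak convergence in $\ell^\infty(\mathcal{G})$), where $G_P^W,G_P^B$ are mean-zero Gaussian processes with covariance functions $\Sigma_P^W(\cdot,\cdot)$, $\Sigma_P^B(\cdot,\cdot)$; the convergence holds uniformly over $P\in\mathcal{P}$ (in bounded-Lipschitz distance); the covariance functions are uniformly bounded, with diagonal entries bounded away from zero, uniformly over $g\in\mathcal{G}$ and $P\in\mathcal{P}$; and there is an estimator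 $\widehat{\Sigma}^B(\cdot,\cdot)$ of $\Sigma_P^B(\cdot,\cdot)$ that is uniformly consistent (over $\mathcal{G}\times\mathcal{G}$ and $P\in\mathcal{P}$).
   Formalization: The exact budget bound can fail by estimation error, uniformly over the class (policies whose welfares differ by n^{-1/2}); it is proved with an added slack δ_n on the right-hand side, for every sequence δ_n with √n·δ_n → ∞ (e.g. any constant ε > 0). *)

theory Defs
  imports "HOL-Probability.Probability"
begin

type_synonym 'p policy = "real ^ 'p \<Rightarrow> real"

type_synonym 'p dgp = "(real \<times> real \<times> (real ^ 'p)) measure"


section \<open>Policies, welfare and budget\<close>

text \<open>
  A triple \<open>(t, c, x)\<close> is a realization of $(\tau, C, X)$. Policies are functions on \<open>\<X>\<close>, so they
  are taken extensional: two policies are equal iff they agree on \<open>\<X>\<close>. Since \<open>X\<close> takes its values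
  in the measurable space \<open>restrict_space borel \<X>\<close>, the set \<open>\<X>\<close> need not be Borel.
\<close>

definition policy_class :: "(real ^ 'p) set \<Rightarrow> 'p policy set \<Rightarrow> bool" where
  "policy_class \<X> \<G> \<longleftrightarrow>
     \<G> \<subseteq> (\<X> \<rightarrow>\<^sub>E {0, 1}) \<and> (\<forall>g\<in>\<G>. g \<in> borel_measurable (restrict_space borel \<X>))"

definition welfare :: "'p policy \<Rightarrow> 'p::finite dgp \<Rightarrow> real" where
  "welfare g P = (\<integral>(t, c, x). t * g x \<partial>P)"

definition budget :: "'p policy \<Rightarrow> 'p::finite dgp \<Rightarrow> real" where
  "budget g P = (\<integral>(t, c, x). c * g x \<partial>P)"

definition data_distribution :: "(real ^ 'p) set \<Rightarrow> 'p policy set \<Rightarrow> 'p::finite dgp \<Rightarrow> bool" where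
  "data_distribution \<X> \<G> P \<longleftrightarrow>
     prob_space P \<and>
     sets P = sets (borel \<Otimes>\<^sub>M (borel \<Otimes>\<^sub>M restrict_space borel \<X>)) \<and>
     (\<forall>g\<in>\<G>. integrable P (\<lambda>(t, c, x). t * g x) \<and> integrable P (\<lambda>(t, c, x). c * g x))"


section \<open>Samples\<close>

text \<open>
  \<open>Pn P n\<close> is the distribution of the observed data for sample size \<open>n\<close> when the data distribution
  is \<open>P\<close>. The data points \<open>d :: 'd\<close> are kept abstract: the covariates \<open>X n i\<close> and the individual
  estimates \<open>\<tau>est n i\<close> and \<open>Cest n i\<close> (with \<open>i < n\<close>) are statistics, i.e. functions of the data alone
  that do not depend on \<open>P\<close>. The estimates may depend on the whole sample.
\<close>

definition sampling ::
  "(real ^ 'p) set \<Rightarrow> ('p::finite dgp \<Rightarrow> nat \<Rightarrow> 'd measure) \<Rightarrow> (nat \<Rightarrow> nat \<Rightarrow> 'd \<Rightarrow> real ^ 'p) \<Rightarrow>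
   (nat \<Rightarrow> nat \<Rightarrow> 'd \<Rightarrow> real) \<Rightarrow> (nat \<Rightarrow> nat \<Rightarrow> 'd \<Rightarrow> real) \<Rightarrow> 'p dgp \<Rightarrow> bool" where
  "sampling \<X> Pn X \<tau>est Cest P \<longleftrightarrow> (\<forall>n.
     prob_space (Pn P n) \<and>
     prob_space.indep_vars (Pn P n) (\<lambda>_. restrict_space borel \<X>) (X n) {..<n} \<and>
     (\<forall>i<n. distr (Pn P n) (restrict_space borel \<X>) (X n i)
              = distr P (restrict_space borel \<X>) (\<lambda>(t, c, x). x)) \<and>
     (\<forall>i<n. \<tau>est n i \<in> borel_measurable (Pn P n) \<and> Cest n i \<in> borel_measurable (Pn P n)))"

definition sample_value ::
  "(nat \<Rightarrow> nat \<Rightarrow> 'd \<Rightarrow> real) \<Rightarrow> (nat \<Rightarrow> nat \<Rightarrow> 'd \<Rightarrow> real ^ 'p) \<Rightarrow> nat \<Rightarrow> 'd \<Rightarrow> 'p::finite policy \<Rightarrow> real"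
where
  "sample_value e X n d g = (\<Sum>i<n. e n i d * g (X n i d)) / real n"

definition tradeoff_objective ::
  "real \<Rightarrow> real \<Rightarrow> real \<Rightarrow> (nat \<Rightarrow> nat \<Rightarrow> 'd \<Rightarrow> real) \<Rightarrow> (nat \<Rightarrow> nat \<Rightarrow> 'd \<Rightarrow> real) \<Rightarrow>
   (nat \<Rightarrow> nat \<Rightarrow> 'd \<Rightarrow> real ^ 'p) \<Rightarrow> nat \<Rightarrow> 'd \<Rightarrow> 'p::finite policy \<Rightarrow> real" where
  "tradeoff_objective lam r k \<tau>est Cest X n d g =
     sample_value \<tau>est X n d g - lam / r * max (sample_value Cest X n d g - k) 0"


section \<open>Uniform convergence to zero of the probability of an event\<close>

text \<open>
  Events that involve a maximizer or a supremum over policies need not be measurable, hence the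
  outer measure; it coincides with the probability on measurable events.
\<close>

definition unif_prob_null ::
  "'p::finite dgp set \<Rightarrow> ('p dgp \<Rightarrow> nat \<Rightarrow> 'd measure) \<Rightarrow> ('p dgp \<Rightarrow> nat \<Rightarrow> 'd \<Rightarrow> bool) \<Rightarrow> bool" where
  "unif_prob_null \<P> Pn E \<longleftrightarrow>
     (\<lambda>n. SUP P\<in>\<P>. outer_measure_of (Pn P n) {d \<in> space (Pn P n). E P n d}) \<longlonglongrightarrow> 0"


section \<open>Weak convergence of bounded processes\<close>

text \<open>$\ell^\infty(S)$ with the supremum distance. Its elements are extensional functions.\<close>

abbreviation linf :: "'i set \<Rightarrow> ('i \<Rightarrow> real) metric" where
  "linf S \<equiv> funspace S euclidean_metric"

definition metric_borel :: "'a metric \<Rightarrow> 'a measure" where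
  "metric_borel m = sigma (mspace m) {U. openin (mtopology_of m) U}"

definition tight_on :: "'a metric \<Rightarrow> 'a measure \<Rightarrow> bool" where
  "tight_on m \<mu> \<longleftrightarrow> (\<forall>\<epsilon>>0. \<exists>K. compactin (mtopology_of m) K \<and> measure \<mu> (space \<mu> - K) < \<epsilon>)"

text \<open>Only meant for bounded \<open>f\<close> and a probability measure \<open>M\<close>.\<close>

definition outer_expectation :: "'a measure \<Rightarrow> ('a \<Rightarrow> real) \<Rightarrow> real" where
  "outer_expectation M f = Inf {(\<integral>x. u x \<partial>M) | u. integrable M u \<and> (\<forall>x\<in>space M. f x \<le> u x)}"

definition BL1 :: "'a metric \<Rightarrow> ('a \<Rightarrow> real) set" where
  "BL1 m = {h. (\<forall>x\<in>mspace m. \<bar>h x\<bar> \<le> 1) \<and>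
               (\<forall>x\<in>mspace m. \<forall>y\<in>mspace m. \<bar>h x - h y\<bar> \<le> mdist m x y)}"

text \<open>
  Bounded-Lipschitz distance, in the sense of Hoffmann-Jorgensen, between a possibly non-measurable
  map \<open>Y\<close> on the probability space \<open>M\<close> and a Borel law \<open>\<mu>\<close>.
\<close>

definition BL_distance :: "'a metric \<Rightarrow> 'd measure \<Rightarrow> ('d \<Rightarrow> 'a) \<Rightarrow> 'a measure \<Rightarrow> real" where
  "BL_distance m M Y \<mu> =
     (SUP h\<in>BL1 m. \<bar>outer_expectation M (\<lambda>d. h (Y d)) - (\<integral>f. h f \<partial>\<mu>)\<bar>)"

text \<open>
  A mean-zero Gaussian process with covariance function \<open>\<Sigma>\<close>, given by its law, a tight Borel
  probability measure on $\ell^\infty(S)$. The finite-dimensional marginals are multivariate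
  normal: the law of $A Z$ with $A A^T = \Sigma$ and $Z$ a vector of independent standard normals.
  This includes degenerate covariance matrices.
\<close>

definition gaussian_process_law :: "'i set \<Rightarrow> ('i \<Rightarrow> 'i \<Rightarrow> real) \<Rightarrow> ('i \<Rightarrow> real) measure \<Rightarrow> bool" where
  "gaussian_process_law S \<Sigma> \<mu> \<longleftrightarrow>
     prob_space \<mu> \<and> sets \<mu> = sets (metric_borel (linf S)) \<and> tight_on (linf S) \<mu> \<and>
     (\<forall>T. finite T \<and> T \<subseteq> S \<longrightarrow>
        (\<exists>(m::nat) A.
           (\<forall>s\<in>T. \<forall>t\<in>T. \<Sigma> s t = (\<Sum>l<m. A s l * A t l)) \<and>
           distr \<mu> (\<Pi>\<^sub>M t\<in>T. borel) (\<lambda>f. restrict f T) =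
             distr (\<Pi>\<^sub>M l\<in>{..<m}. density lborel std_normal_density) (\<Pi>\<^sub>M t\<in>T. borel)
               (\<lambda>z. \<lambda>t\<in>T. \<Sum>l<m. A t l * z l)))"


section \<open>The estimation-quality assumption\<close>

definition recentered ::
  "'p policy set \<Rightarrow> (nat \<Rightarrow> 'd \<Rightarrow> 'p policy \<Rightarrow> real) \<Rightarrow> ('p policy \<Rightarrow> 'p::finite dgp \<Rightarrow> real) \<Rightarrow>
   'p dgp \<Rightarrow> nat \<Rightarrow> 'd \<Rightarrow> 'p policy \<Rightarrow> real" where
  "recentered \<G> est target P n d = (\<lambda>g\<in>\<G>. sqrt (real n) * (est n d g - target g P))"

text \<open>
  \<open>G P\<close> is the law of the limit process under \<open>P\<close>. The first conjunct says that the recentered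
  processes take their values in $\ell^\infty(\mathcal G)$.
\<close>

definition unif_gaussian_limit ::
  "'p policy set \<Rightarrow> 'p::finite dgp set \<Rightarrow> ('p dgp \<Rightarrow> nat \<Rightarrow> 'd measure) \<Rightarrow>
   (nat \<Rightarrow> 'd \<Rightarrow> 'p policy \<Rightarrow> real) \<Rightarrow> ('p policy \<Rightarrow> 'p dgp \<Rightarrow> real) \<Rightarrow>
   ('p dgp \<Rightarrow> 'p policy \<Rightarrow> 'p policy \<Rightarrow> real) \<Rightarrow> ('p dgp \<Rightarrow> ('p policy \<Rightarrow> real) measure) \<Rightarrow> bool" where
  "unif_gaussian_limit \<G> \<P> Pn est target \<Sigma> G \<longleftrightarrow>
     (\<forall>P\<in>\<P>. \<forall>n. \<forall>d\<in>space (Pn P n). recentered \<G> est target P n d \<in> mspace (linf \<G>)) \<and>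
     (\<forall>P\<in>\<P>. gaussian_process_law \<G> (\<Sigma> P) (G P)) \<and>
     uniform_limit \<P>
       (\<lambda>n P. BL_distance (linf \<G>) (Pn P n) (recentered \<G> est target P n) (G P))
       (\<lambda>_. 0) sequentially"

definition unif_regular_cov ::
  "'p policy set \<Rightarrow> 'p::finite dgp set \<Rightarrow> ('p dgp \<Rightarrow> 'p policy \<Rightarrow> 'p policy \<Rightarrow> real) \<Rightarrow> bool" where
  "unif_regular_cov \<G> \<P> \<Sigma> \<longleftrightarrow>
     (\<exists>b. \<forall>P\<in>\<P>. \<forall>g\<in>\<G>. \<forall>h\<in>\<G>. \<bar>\<Sigma> P g h\<bar> \<le> b) \<and>
     (\<exists>a>0. \<forall>P\<in>\<P>. \<forall>g\<in>\<G>. a \<le> \<Sigma> P g g)"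

definition unif_consistent_cov_estimator ::
  "'p policy set \<Rightarrow> 'p::finite dgp set \<Rightarrow> ('p dgp \<Rightarrow> nat \<Rightarrow> 'd measure) \<Rightarrow>
   ('p dgp \<Rightarrow> 'p policy \<Rightarrow> 'p policy \<Rightarrow> real) \<Rightarrow> (nat \<Rightarrow> 'd \<Rightarrow> 'p policy \<Rightarrow> 'p policy \<Rightarrow> real) \<Rightarrow> bool"
where
  "unif_consistent_cov_estimator \<G> \<P> Pn \<Sigma> \<Sigma>est \<longleftrightarrow>
     (\<forall>P\<in>\<P>. \<forall>n. \<forall>g\<in>\<G>. \<forall>h\<in>\<G>. (\<lambda>d. \<Sigma>est n d g h) \<in> borel_measurable (Pn P n)) \<and>
     (\<forall>\<epsilon>>0. unif_prob_null \<P> Pn (\<lambda>P n d. \<exists>g\<in>\<G>. \<exists>h\<in>\<G>. \<epsilon> < \<bar>\<Sigma>est n d g h - \<Sigma> P g h\<bar>))"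

definition estimation_quality ::
  "'p policy set \<Rightarrow> 'p::finite dgp set \<Rightarrow> ('p dgp \<Rightarrow> nat \<Rightarrow> 'd measure) \<Rightarrow>
   (nat \<Rightarrow> nat \<Rightarrow> 'd \<Rightarrow> real ^ 'p) \<Rightarrow> (nat \<Rightarrow> nat \<Rightarrow> 'd \<Rightarrow> real) \<Rightarrow> (nat \<Rightarrow> nat \<Rightarrow> 'd \<Rightarrow> real) \<Rightarrow> bool"
where
  "estimation_quality \<G> \<P> Pn X \<tau>est Cest \<longleftrightarrow>
     (\<exists>\<Sigma>W \<Sigma>B GW GB \<Sigma>Best.
        unif_gaussian_limit \<G> \<P> Pn (sample_value \<tau>est X) welfare \<Sigma>W GW \<and>
        unif_gaussian_limit \<G> \<P> Pn (sample_value Cest X) budget \<Sigma>B GB \<and>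
        unif_regular_cov \<G> \<P> \<Sigma>W \<and> unif_regular_cov \<G> \<P> \<Sigma>B \<and>
        unif_consistent_cov_estimator \<G> \<P> Pn \<Sigma>B \<Sigma>Best)"


section \<open>Slack in the budget bound\<close>

text \<open>
  The estimation errors, and hence the loss from maximizing the estimated instead of the true
  objective, are of order $n^{-1/2}$. So \<open>r (W(ghat) - W(gstar)) / lam\<close> is negative, and smaller
  than any positive part, with probability bounded away from zero if \<open>\<P>\<close> contains for each \<open>n\<close> a
  distribution with two feasible policies whose welfares differ by $n^{-1/2}$. A bound that holds
  with probability approaching one, uniformly over \<open>\<P>\<close>, therefore needs a slack \<open>\<delta>\<close>. It may be any
  sequence of larger order than $n^{-1/2}$, for instance a constant \<open>\<epsilon> > 0\<close>.
\<close>

definition exceeds_root_n :: "(nat \<Rightarrow> real) \<Rightarrow> bool" where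
  "exceeds_root_n \<delta> \<longleftrightarrow> filterlim (\<lambda>n. sqrt (real n) * \<delta> n) at_top sequentially"

end

theory Submission
  imports Defs
begin

text \<open>
  Outside an event of small probability both recentered processes are bounded by a constant \<open>C\<close>
  in supremum norm. Then the estimated objective is within $O(C / \sqrt n)$ of the population
  objective, uniformly over policies, and comparing \<open>ghat\<close> with \<open>gstar\<close> gives both claims.

  The point is that \<open>C\<close> must not depend on the data distribution. Bounded variances alone do not bound
  the supremum of a Gaussian process. But policies are binary, so for a fixed sample size \<open>n\<close> the
  process takes at most $2^n$ values over the whole class. Being close to it in bounded-Lipschitz
  distance, the Gaussian limit plus a fixed function \<open>s\<close> rarely has $2^n + 1$ values that are pairwise
  at distance at least 1. A Gaussian process of bounded variance that is often large would have them:
  write it as a unit-length combination of independent copies of itself. Each of many copies is large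
  at some index of its own, where the other copies are of order 1, so for most choices of the weights
  these indices are pairwise well separated.
\<close>

section \<open>Vectors of independent standard normals\<close>

text \<open>Because the convergence is uniform over \<open>\<P>\<close>, a single sample size
  \<open>n0\<close> serves every law at once, and the bound \<open>K\<close> on the number of values
  of the estimate is one constant. Centring obstructs a direct count: the recentered process
  subtracts the unknown population value of each policy and may take infinitely many values. Adding
  back a fixed function \<open>s\<close> undoes this. Nothing is known about \<open>s\<close>, so
  the argument only estimates differences between mixtures with different weights, in which
  \<open>s\<close> cancels. The contradiction is a double count. For fixed unit weights the mixture
  has the law of one copy, so it is spread with probability at most 1/4. Yet with probability at
  least 1/2, at least 3/4 of the weights on a finite grid give a spread mixture, so the average
  probability over the grid is at least 3/8. All constants come from the tail probability, the
  variance bound and \<open>K\<close>; neither the dimension of the Gaussian vector nor the number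
  of indices enters.\<close>

lemma prob_space_PiM_std_normal: "prob_space (\<Pi>\<^sub>M l\<in>L. std_normal_distribution)"
  by (intro prob_space_PiM prob_space_normal_density) simp

lemma indep_vars_PiM_std_normal:
  assumes "L \<noteq> {}"
  shows "prob_space.indep_vars (\<Pi>\<^sub>M l\<in>L. std_normal_distribution) (\<lambda>_. borel) (\<lambda>l z. z l) L"
proof -
  interpret prob_space "\<Pi>\<^sub>M l\<in>L. std_normal_distribution"
    by (rule prob_space_PiM_std_normal)
  have "distr (\<Pi>\<^sub>M l\<in>L. std_normal_distribution) (\<Pi>\<^sub>M l\<in>L. borel) (\<lambda>z. \<lambda>l\<in>L. z l) =
        distr (\<Pi>\<^sub>M l\<in>L. std_normal_distribution) (\<Pi>\<^sub>M l\<in>L. std_normal_distribution) (\<lambda>z. z)"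
    by (intro distr_cong refl sets_PiM_cong) (auto simp: space_PiM PiE_restrict)
  also have "\<dots> = (\<Pi>\<^sub>M l\<in>L. std_normal_distribution)"
    by (rule distr_id)
  also have "\<dots> = (\<Pi>\<^sub>M l\<in>L. distr (\<Pi>\<^sub>M l\<in>L. std_normal_distribution) borel (\<lambda>z. z l))"
  proof (intro PiM_cong refl)
    fix l assume "l \<in> L"
    have "distr (\<Pi>\<^sub>M l\<in>L. std_normal_distribution) borel (\<lambda>z. z l) =
          distr (\<Pi>\<^sub>M l\<in>L. std_normal_distribution) std_normal_distribution (\<lambda>z. z l)"
      by (intro distr_cong) auto
    also have "\<dots> = std_normal_distribution"
      using \<open>l \<in> L\<close> by (intro distr_PiM_component prob_space_normal_density) auto
    finally show "std_normal_distribution =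
        distr (\<Pi>\<^sub>M l\<in>L. std_normal_distribution) borel (\<lambda>z. z l)" by simp
  qed
  finally show ?thesis
    using assms by (subst indep_vars_iff_distr_eq_PiM') auto
qed

lemma distributed_std_normal_combination:
  assumes "finite K" "K \<subseteq> L" and \<sigma>: "(\<Sum>l\<in>K. (a l)\<^sup>2) = \<sigma>\<^sup>2" "\<sigma> > 0"
  shows "distributed (\<Pi>\<^sub>M l\<in>L. std_normal_distribution) lborel
           (\<lambda>z. \<Sum>l\<in>K. a l * z l) (normal_density 0 \<sigma>)"
proof -
  interpret prob_space "\<Pi>\<^sub>M l\<in>L. std_normal_distribution"
    by (rule prob_space_PiM_std_normal)
  \<comment> \<open>Zero coefficients are dropped because \<open>sum_indep_normal\<close> and
    \<open>normal_density_affine\<close> need nondegenerate summands.\<close>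
  define K' where "K' = {l\<in>K. a l \<noteq> 0}"
  have K': "finite K'" "K' \<subseteq> L" "\<And>l. l \<in> K' \<Longrightarrow> a l \<noteq> 0"
    using assms by (auto simp: K'_def)
  have sum_K': "(\<Sum>l\<in>K. (a l)\<^sup>2) = (\<Sum>l\<in>K'. (a l)\<^sup>2)"
    using assms by (intro sum.mono_neutral_right) (auto simp: K'_def)
  have "K' \<noteq> {}"
    using \<sigma> sum_K' by auto
  have "distributed (\<Pi>\<^sub>M l\<in>L. std_normal_distribution) lborel
      (\<lambda>z. \<Sum>l\<in>K'. a l * z l) (normal_density (\<Sum>l\<in>K'. 0) (sqrt (\<Sum>l\<in>K'. (\<bar>a l\<bar> * 1)\<^sup>2)))"
  proof (rule sum_indep_normal)
    have "L \<noteq> {}" using \<open>K' \<noteq> {}\<close> K' by auto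
    show "indep_vars (\<lambda>i. borel) (\<lambda>l z. a l * z l) K'"
      by (rule indep_vars_compose2[OF indep_vars_subset[OF indep_vars_PiM_std_normal[OF \<open>L \<noteq> {}\<close>] K'(2)]])
         auto
  next
    fix l assume l: "l \<in> K'"
    have "distr (\<Pi>\<^sub>M l\<in>L. std_normal_distribution) lborel (\<lambda>z. z l) =
          distr (\<Pi>\<^sub>M l\<in>L. std_normal_distribution) std_normal_distribution (\<lambda>z. z l)"
      by (intro distr_cong) auto
    also have "\<dots> = std_normal_distribution"
      using l K' by (intro distr_PiM_component prob_space_normal_density) auto
    finally have "distributed (\<Pi>\<^sub>M l\<in>L. std_normal_distribution) lborel (\<lambda>z. z l) std_normal_density"
      using l K' by (auto simp: distributed_def)
    from normal_density_affine[OF this, of "a l" 0]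
    show "distributed (\<Pi>\<^sub>M l\<in>L. std_normal_distribution) lborel (\<lambda>z. a l * z l) 
            (normal_density 0 (\<bar>a l\<bar> * 1))"
      using K'(3)[OF l] by simp
  qed (use \<open>K' \<noteq> {}\<close> K' in auto)
  moreover have "(\<Sum>l\<in>K. a l * z l) = (\<Sum>l\<in>K'. a l * z l)" for z :: "_ \<Rightarrow> real"
    using assms by (intro sum.mono_neutral_right) (auto simp: K'_def)
  ultimately show ?thesis
    using \<sigma> sum_K' by simp
qed

text \<open>Chebyshev's inequality. A polynomial tail is enough, since the bound is later summed
  only over pairs of copies and never over the indices in \<open>T\<close>. Zero variance is split
  off because there is then no normal density.\<close>

lemma std_normal_combination_tail:
  assumes "finite L" and b: "(\<Sum>l\<in>L. (a l)\<^sup>2) \<le> b" and R: "R > 0"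
  shows "measure (\<Pi>\<^sub>M l\<in>L. std_normal_distribution)
           {z \<in> space (\<Pi>\<^sub>M l\<in>L. std_normal_distribution). R \<le> \<bar>\<Sum>l\<in>L. a l * z l\<bar>} \<le> b / R\<^sup>2"
proof -
  interpret prob_space "\<Pi>\<^sub>M l\<in>L. std_normal_distribution"
    by (rule prob_space_PiM_std_normal)
  define \<sigma> where "\<sigma> = sqrt (\<Sum>l\<in>L. (a l)\<^sup>2)"
  have \<sigma>2: "(\<Sum>l\<in>L. (a l)\<^sup>2) = \<sigma>\<^sup>2"
    by (simp add: \<sigma>_def sum_nonneg)
  show ?thesis
  proof (cases "\<sigma> = 0")
    case True
    then have "\<forall>l\<in>L. a l = 0"
      using \<sigma>2 assms by (simp add: sum_nonneg_eq_0_iff)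
    then have "{z \<in> space (\<Pi>\<^sub>M l\<in>L. std_normal_distribution). R \<le> \<bar>\<Sum>l\<in>L. a l * z l\<bar>} = {}"
      using R by auto
    then have "prob {z \<in> space (\<Pi>\<^sub>M l\<in>L. std_normal_distribution). R \<le> \<bar>\<Sum>l\<in>L. a l * z l\<bar>} = 0"
      by (simp only: measure_empty)
    also have "0 \<le> b / R\<^sup>2"
      using b \<sigma>2 by (simp add: True)
    finally show ?thesis .
  next
    case False
    then have "\<sigma> > 0"
      by (simp add: \<sigma>_def sum_nonneg order_less_le)
    note D = distributed_std_normal_combination[OF \<open>finite L\<close> subset_refl \<sigma>2 this]
    have [measurable]: "random_variable borel (\<lambda>z. \<Sum>l\<in>L. a l * z l)"
      using distributed_measurable[OF D] by simp
    have E: "expectation (\<lambda>z. \<Sum>l\<in>L. a l * z l) = 0"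
      by (rule normal_distributed_expectation[OF \<open>\<sigma> > 0\<close> D])
    have V: "variance (\<lambda>z. \<Sum>l\<in>L. a l * z l) = \<sigma>\<^sup>2"
      by (rule normal_distributed_variance[OF \<open>\<sigma> > 0\<close> D])
    \<comment> \<open>A nonintegrable function has integral 0 by convention, whereas this integral
      is the variance \<open>\<sigma>\<^sup>2 > 0\<close>.\<close>
    have "integrable (\<Pi>\<^sub>M l\<in>L. std_normal_distribution) (\<lambda>z. (\<Sum>l\<in>L. a l * z l)\<^sup>2)"
    proof (rule ccontr)
      assume "\<not> ?thesis"
      from not_integrable_integral_eq[OF this] show False
        using V E \<open>\<sigma> > 0\<close> by simp
    qed
    from Chebyshev_inequality[OF _ this R] V E
    have "prob {z \<in> space (\<Pi>\<^sub>M l\<in>L. std_normal_distribution). R \<le> \<bar>\<Sum>l\<in>L. a l * z l\<bar>} \<le> \<sigma>\<^sup>2 / R\<^sup>2"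
      by simp
    also have "\<dots> \<le> b / R\<^sup>2"
      using b \<sigma>2 by (intro divide_right_mono) auto
    finally show ?thesis .
  qed
qed

text \<open>Rotation invariance of the Gaussian law. Coordinate \<open>l\<close> of the mixture only
  uses the block \<open>I \<times> {l}\<close>; the blocks are disjoint, so the coordinates stay
  independent, and each is normal with variance the sum of the squared weights. An empty
  \<open>L\<close> is separate because the product criterion for independence needs an
  index.\<close>

lemma distr_std_normal_vector_combination:
  assumes "finite I" "finite L" and w: "(\<Sum>i\<in>I. (w i)\<^sup>2) = 1"
  shows "distr (\<Pi>\<^sub>M p\<in>I\<times>L. std_normal_distribution) (\<Pi>\<^sub>M l\<in>L. borel)
           (\<lambda>\<omega>. \<lambda>l\<in>L. \<Sum>i\<in>I. w i * \<omega> (i, l)) = (\<Pi>\<^sub>M l\<in>L. std_normal_distribution)"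
proof (cases "L = {}")
  case True
  interpret prob_space "\<Pi>\<^sub>M p\<in>I\<times>L. std_normal_distribution"
    by (rule prob_space_PiM_std_normal)
  have "prob_space (distr (\<Pi>\<^sub>M p\<in>I\<times>L. std_normal_distribution) (\<Pi>\<^sub>M l\<in>L. borel)
           (\<lambda>\<omega>. \<lambda>l\<in>L. \<Sum>i\<in>I. w i * \<omega> (i, l)))"
    by (rule prob_space_distr) (auto simp: True PiM_empty)
  from prob_space.emeasure_space_1[OF this] show ?thesis
    using True by (intro measure_eqI) (auto simp: PiM_empty subset_singleton_iff)
next
  case False
  interpret prob_space "\<Pi>\<^sub>M p\<in>I\<times>L. std_normal_distribution"
    by (rule prob_space_PiM_std_normal)
  have "I \<noteq> {}" using w by auto
  then have ne: "I \<times> L \<noteq> {}" using False by auto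
  have "indep_vars (\<lambda>_. borel) (\<lambda>l \<omega>. \<Sum>p\<in>I \<times> {l}. w (fst p) * (restrict (\<lambda>p. \<omega> p) (I \<times> {l})) p) L"
    by (rule indep_vars_compose2[OF indep_vars_restrict[OF indep_vars_PiM_std_normal[OF ne]]])
       (auto simp: disjoint_family_on_def)
  then have indep: "indep_vars (\<lambda>_. borel) (\<lambda>l \<omega>. \<Sum>i\<in>I. w i * \<omega> (i, l)) L"
    by (simp add: sum.cartesian_product')
  have "distr (\<Pi>\<^sub>M p\<in>I\<times>L. std_normal_distribution) borel (\<lambda>\<omega>. \<Sum>i\<in>I. w i * \<omega> (i, l)) =
        std_normal_distribution" if "l \<in> L" for l
  proof -
    have "distributed (\<Pi>\<^sub>M p\<in>I\<times>L. std_normal_distribution) lborel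
        (\<lambda>\<omega>. \<Sum>p\<in>I \<times> {l}. w (fst p) * \<omega> p) (normal_density 0 1)"
      using w that \<open>finite I\<close> by (intro distributed_std_normal_combination) (auto simp: sum.cartesian_product')
    then have "distr (\<Pi>\<^sub>M p\<in>I\<times>L. std_normal_distribution) lborel (\<lambda>\<omega>. \<Sum>i\<in>I. w i * \<omega> (i, l)) =
        std_normal_distribution"
      by (simp add: distributed_def sum.cartesian_product')
    moreover have "distr (\<Pi>\<^sub>M p\<in>I\<times>L. std_normal_distribution) borel (\<lambda>\<omega>. \<Sum>i\<in>I. w i * \<omega> (i, l)) =
        distr (\<Pi>\<^sub>M p\<in>I\<times>L. std_normal_distribution) lborel (\<lambda>\<omega>. \<Sum>i\<in>I. w i * \<omega> (i, l))"
      by (intro distr_cong) auto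
    ultimately show ?thesis
      by simp
  qed
  then show ?thesis
    using False indep by (subst (asm) indep_vars_iff_distr_eq_PiM')
       (auto intro!: PiM_cong)
qed

section \<open>Gaussian processes that are rarely spread out\<close>

text \<open>\<open>{..K}\<close> has \<open>K + 1\<close> elements, one more than the number of
  values allowed to a few-valued process, so that the pigeonhole principle applies. Extensional
  choices \<open>\<tau>\<close> are finite in number for finite \<open>T\<close>, which makes the
  event measurable.\<close>

definition spread :: "nat \<Rightarrow> 't set \<Rightarrow> ('t \<Rightarrow> real) \<Rightarrow> bool" where
  "spread K T f \<longleftrightarrow> (\<exists>\<tau>\<in>{..K} \<rightarrow>\<^sub>E T. \<forall>i\<in>{..K}. \<forall>j\<in>{..K}. i \<noteq> j \<longrightarrow> 1 \<le> \<bar>f (\<tau> i) - f (\<tau> j)\<bar>)"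

lemma spreadI:
  assumes "\<tau> \<in> {..K} \<rightarrow> T"
    and "\<And>i j. i \<le> K \<Longrightarrow> j \<le> K \<Longrightarrow> i \<noteq> j \<Longrightarrow> 1 \<le> \<bar>f (\<tau> i) - f (\<tau> j)\<bar>"
  shows "spread K T f"
  unfolding spread_def using assms by (intro bexI[of _ "restrict \<tau> {..K}"]) auto

text \<open>Forgetting coordinate \<open>l\<close> is injective on \<open>D\<close>, so
  \<open>D\<close> fills at most the fraction \<open>1 / Q\<close> of the grid.\<close>

lemma card_PiE_one_coordinate_determined:
  assumes "finite I" "l \<in> I" "D \<subseteq> I \<rightarrow>\<^sub>E {..<Q::nat}"
    and det: "\<And>q q'. q \<in> D \<Longrightarrow> q' \<in> D \<Longrightarrow> (\<And>i. i \<in> I - {l} \<Longrightarrow> q i = q' i) \<Longrightarrow> q l = q' l"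
  shows "card D \<le> Q ^ (card I - 1)"
proof -
  have "inj_on (\<lambda>q. restrict q (I - {l})) D"
  proof (rule inj_onI)
    fix q q' assume q: "q \<in> D" "q' \<in> D" and eq: "restrict q (I - {l}) = restrict q' (I - {l})"
    have off: "q i = q' i" if "i \<in> I - {l}" for i
      using fun_cong[OF eq, of i] that by simp
    show "q = q'"
    proof (rule PiE_ext)
      show "q \<in> I \<rightarrow>\<^sub>E {..<Q}" "q' \<in> I \<rightarrow>\<^sub>E {..<Q}" using q assms(3) by auto
      show "q i = q' i" if "i \<in> I" for i
        using off det[OF q off] that by (cases "i = l") auto
    qed
  qed
  then have "card D \<le> card ((I - {l}) \<rightarrow>\<^sub>E {..<Q})"
  proof (rule card_inj_on_le)
    show "(\<lambda>q. restrict q (I - {l})) ` D \<subseteq> (I - {l}) \<rightarrow>\<^sub>E {..<Q}"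
    proof (rule image_subsetI)
      fix q assume "q \<in> D"
      then have "q \<in> I \<rightarrow>\<^sub>E {..<Q}" using assms(3) by blast
      then show "restrict q (I - {l}) \<in> (I - {l}) \<rightarrow>\<^sub>E {..<Q}"
        by (simp add: PiE_iff)
    qed
    show "finite ((I - {l}) \<rightarrow>\<^sub>E {..<Q})"
      using assms(1) by (intro finite_PiE) auto
  qed
  also have "\<dots> = Q ^ (card I - 1)"
    using assms by (simp add: card_PiE)
  finally show ?thesis .
qed

text \<open>
  If all weights but that of copy \<open>ix j\<close> are fixed, at most one grid value of the latter puts the values
  at \<open>t j\<close> and \<open>t j'\<close> within distance 1: copy \<open>ix j\<close> is at least \<open>C\<close> at \<open>t j\<close> and at most \<open>R\<close> at \<open>t j'\<close>,
  while the compensating copy \<open>v\<close>, which makes the weights a unit vector, is at most \<open>R\<close> at both.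
\<close>

lemma few_mixtures_not_spread:
  fixes u :: "'i \<Rightarrow> 't \<Rightarrow> real" and v s :: "'t \<Rightarrow> real" and I :: "'i set" and \<alpha> R C :: real
  defines "w \<equiv> \<lambda>q::'i \<Rightarrow> nat. sqrt (1 - (\<Sum>i\<in>I. (\<alpha> * real (q i))\<^sup>2))"
  assumes fin: "finite I" and ix: "ix \<in> {..K} \<rightarrow> I" and t: "t \<in> {..K} \<rightarrow> T"
    and \<alpha>: "\<alpha> > 0" "\<alpha> * (C - R) \<ge> 2 * R + 2"
    and le1: "\<And>q. q \<in> I \<rightarrow>\<^sub>E {..<Q} \<Longrightarrow> (\<Sum>i\<in>I. (\<alpha> * real (q i))\<^sup>2) \<le> 1"
    and big: "\<And>j. j \<le> K \<Longrightarrow> C \<le> \<bar>u (ix j) (t j)\<bar>"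
    and small: "\<And>j j'. j \<le> K \<Longrightarrow> j' \<le> K \<Longrightarrow> j \<noteq> j' \<Longrightarrow> \<bar>u (ix j) (t j')\<bar> \<le> R"
    and small_v: "\<And>j. j \<le> K \<Longrightarrow> \<bar>v (t j)\<bar> \<le> R"
  shows "card {q \<in> I \<rightarrow>\<^sub>E {..<Q}. \<not> spread K T (\<lambda>x. (\<Sum>i\<in>I. \<alpha> * real (q i) * u i x) + w q * v x + s x)}
           \<le> (K + 1)\<^sup>2 * Q ^ (card I - 1)"
proof -
  define G where "G = (\<lambda>q x. (\<Sum>i\<in>I. \<alpha> * real (q i) * u i x) + w q * v x + s x)"
  define D where "D = (\<lambda>(j, j'). {q \<in> I \<rightarrow>\<^sub>E {..<Q}. \<bar>G q (t j) - G q (t j')\<bar> < 1})"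
  define J where "J = {p \<in> {..K} \<times> {..K}. fst p \<noteq> snd p}"
  have w01: "0 \<le> w q \<and> w q \<le> 1" if "q \<in> I \<rightarrow>\<^sub>E {..<Q}" for q
    using le1[OF that] by (simp add: w_def sum_nonneg)
  have card_D: "card (D p) \<le> Q ^ (card I - 1)" if p: "p \<in> J" for p
  proof (rule card_PiE_one_coordinate_determined[where l = "ix (fst p)"])
    show "finite I" "ix (fst p) \<in> I" "D p \<subseteq> I \<rightarrow>\<^sub>E {..<Q}"
      using fin ix p by (auto simp: J_def D_def)
    fix q q' assume q: "q \<in> D p" "q' \<in> D p"
      and eq: "\<And>i. i \<in> I - {ix (fst p)} \<Longrightarrow> q i = q' i"
    define l j j' where "l = ix (fst p)" and "j = fst p" and "j' = snd p"
    have j: "j \<le> K" "j' \<le> K" "j \<noteq> j'" "l = ix j" and "l \<in> I"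
      using p ix by (auto simp: J_def l_def j_def j'_def)
    show "q (ix (fst p)) = q' (ix (fst p))"
    proof (rule ccontr)
      assume "q (ix (fst p)) \<noteq> q' (ix (fst p))"
      then have ne: "1 \<le> \<bar>real (q l) - real (q' l)\<bar>"
        by (auto simp: l_def)
      \<comment> \<open>Moving the weight of copy \<open>l\<close> changes the difference between
        the values at \<open>t j\<close> and \<open>t j'\<close> by \<open>X + Y\<close>. Two
        differences below 1 force \<open>\<bar>X + Y\<bar> < 2\<close>. But
        \<open>\<bar>Y\<bar> \<le> 2 * R\<close>, and one grid step gives
        \<open>\<bar>X\<bar> \<ge> \<alpha> * (C - R) \<ge> 2 * R + 2\<close>; this is where
        \<open>2 * R + 2\<close> comes from.\<close>
      define X where "X = \<alpha> * (real (q l) - real (q' l)) * (u l (t j) - u l (t j'))"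
      define Y where "Y = (w q - w q') * (v (t j) - v (t j'))"
      have "(G q x - G q' x) = \<alpha> * (real (q l) - real (q' l)) * u l x + (w q - w q') * v x" for x
      proof -
        have "G q x - G q' x = (\<Sum>i\<in>I. \<alpha> * (real (q i) - real (q' i)) * u i x) + (w q - w q') * v x"
          by (simp add: G_def sum_subtractf algebra_simps)
        also have "(\<Sum>i\<in>I. \<alpha> * (real (q i) - real (q' i)) * u i x) =
                   \<alpha> * (real (q l) - real (q' l)) * u l x"
          using \<open>l \<in> I\<close> fin eq by (subst sum.remove[of _ l]) (auto simp: l_def intro!: sum.neutral)
        finally show ?thesis .
      qed
      note Gdiff = this[of "t j"] this[of "t j'"]
      have XY: "(G q (t j) - G q (t j')) - (G q' (t j) - G q' (t j')) = X + Y"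
        using Gdiff by (simp add: X_def Y_def algebra_simps)
      have "\<bar>G q (t j) - G q (t j')\<bar> < 1" "\<bar>G q' (t j) - G q' (t j')\<bar> < 1"
        using q by (auto simp: D_def j_def j'_def split: prod.splits)
      then have "\<bar>X + Y\<bar> < 2" using XY by linarith
      moreover have "\<bar>Y\<bar> \<le> 1 * (2 * R)"
        unfolding Y_def abs_mult
      proof (rule mult_mono)
        show "\<bar>w q - w q'\<bar> \<le> 1"
          using w01[of q] w01[of q'] q by (force simp: D_def split: prod.splits)
        show "\<bar>v (t j) - v (t j')\<bar> \<le> 2 * R"
          using small_v[OF j(1)] small_v[OF j(2)] by linarith
      qed auto
      moreover have "\<alpha> * 1 * (C - R) \<le> \<bar>X\<bar>"
        unfolding X_def abs_mult
      proof (intro mult_mono)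
        show "C - R \<le> \<bar>u l (t j) - u l (t j')\<bar>"
          using big[OF j(1)] small[OF j(1,2,3)] by (simp add: j(4))
        have "0 \<le> R" using small_v[OF j(1)] by linarith
        then have "0 \<le> \<alpha> * (C - R)" using \<alpha> by linarith
        then show "0 \<le> C - R" using \<alpha>(1) by (simp add: zero_le_mult_iff)
      qed (use ne \<alpha> in auto)
      ultimately show False using \<alpha>(2) by linarith
    qed
  qed
  have "{q \<in> I \<rightarrow>\<^sub>E {..<Q}. \<not> spread K T (G q)} \<subseteq> (\<Union>p\<in>J. D p)"
  proof safe
    fix q assume q: "q \<in> I \<rightarrow>\<^sub>E {..<Q}" and ns: "\<not> spread K T (G q)"
    from spreadI[OF t, of "G q"] ns obtain i j
      where "i \<le> K" "j \<le> K" "i \<noteq> j" "\<bar>G q (t i) - G q (t j)\<bar> < 1"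
      by (meson not_le)
    then show "q \<in> (\<Union>p\<in>J. D p)"
      using q by (intro UN_I[of "(i, j)"]) (auto simp: J_def D_def)
  qed
  moreover have "finite (\<Union>p\<in>J. D p)"
    using fin by (auto simp: J_def D_def intro!: finite_PiE)
  ultimately have "card {q \<in> I \<rightarrow>\<^sub>E {..<Q}. \<not> spread K T (G q)} \<le> card (\<Union>p\<in>J. D p)"
    by (rule card_mono[rotated])
  also have "\<dots> \<le> (\<Sum>p\<in>J. card (D p))"
    by (rule card_UN_le) (simp add: J_def)
  also have "\<dots> \<le> card J * Q ^ (card I - 1)"
    using sum_bounded_above[of J "\<lambda>p. card (D p)" "Q ^ (card I - 1)"] card_D by simp
  also have "\<dots> \<le> (K + 1)\<^sup>2 * Q ^ (card I - 1)"
  proof (rule mult_right_mono)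
    have "card J \<le> card ({..K} \<times> {..K})"
      unfolding J_def by (intro card_mono) auto
    then show "card J \<le> (K + 1)\<^sup>2"
      by (simp add: power2_eq_square)
  qed simp
  finally show ?thesis by (simp add: G_def)
qed

section \<open>Measurability of spreading and of selected indices\<close>

lemma spread_sets [measurable (raw)]:
  assumes "finite T" and [measurable]: "\<And>t. t \<in> T \<Longrightarrow> f t \<in> borel_measurable M"
  shows "Measurable.pred M (\<lambda>x. spread K T (\<lambda>t. f t x))"
proof -
  have "finite ({..K} \<rightarrow>\<^sub>E T)"
    using assms by (intro finite_PiE) auto
  moreover have "Measurable.pred M (\<lambda>x. \<forall>i\<in>{..K}. \<forall>j\<in>{..K}. i \<noteq> j \<longrightarrow> 1 \<le> \<bar>f (\<tau> i) x - f (\<tau> j) x\<bar>)"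
    if \<tau>: "\<tau> \<in> {..K} \<rightarrow>\<^sub>E T" for \<tau>
  proof -
    have "f (\<tau> i) \<in> borel_measurable M" if "i \<in> {..K}" for i
      using PiE_mem[OF \<tau> that] assms by blast
    note [measurable] = this
    show ?thesis by measurable
  qed
  ultimately show ?thesis
    unfolding spread_def by (intro pred_intros_finite(4))
qed

text \<open>The choice made by \<open>SOME\<close> depends on \<open>x\<close> only through the set
  of indices at which \<open>P\<close> holds, and this set has finitely many possible values. The
  empty set is one of them; it selects a fixed arbitrary element.\<close>

lemma sets_finite_selection:
  assumes "finite T" and [measurable]: "\<And>t. t \<in> T \<Longrightarrow> Measurable.pred M (P t)"
  shows "{x \<in> space M. (SOME t. t \<in> T \<and> P t x) = t} \<in> sets M"
proof -
  have "{x \<in> space M. (SOME t. t \<in> T \<and> P t x) = t} =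
        (\<Union>B\<in>{B \<in> Pow T. (SOME t. t \<in> B) = t}. {x \<in> space M. \<forall>t\<in>T. P t x \<longleftrightarrow> t \<in> B})"
  proof safe
    fix x assume "x \<in> space M"
    then show "x \<in> (\<Union>B\<in>{B \<in> Pow T. (SOME t. t \<in> B) = (SOME t. t \<in> T \<and> P t x)}.
                 {x \<in> space M. \<forall>t\<in>T. P t x \<longleftrightarrow> t \<in> B})"
      by (intro UN_I[of "{t \<in> T. P t x}"]) auto
  next
    fix x B assume "B \<subseteq> T" and B: "\<forall>t\<in>T. P t x \<longleftrightarrow> t \<in> B"
    then have "(\<lambda>t. t \<in> T \<and> P t x) = (\<lambda>t. t \<in> B)" by auto
    then show "(SOME t. t \<in> T \<and> P t x) = (SOME t. t \<in> B)" by simp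
  qed
  also have "\<dots> \<in> sets M"
  proof (rule sets.finite_UN)
    show "finite {B \<in> Pow T. (SOME t. t \<in> B) = t}"
      using assms by simp
    show "{x \<in> space M. \<forall>t\<in>T. P t x \<longleftrightarrow> t \<in> B} \<in> sets M" for B
      using assms(1) by measurable
  qed
  finally show ?thesis .
qed

section \<open>Independent copies of a Gaussian vector\<close>

lemma std_normal_blocks:
  fixes I :: "'i set" and m :: nat
  assumes "finite I"
  defines "\<Omega> \<equiv> \<Pi>\<^sub>M p\<in>I\<times>{..<m}. std_normal_distribution"
    and "\<xi> \<equiv> \<lambda>i (\<omega>::'i \<times> nat \<Rightarrow> real). \<lambda>l\<in>{..<m}. \<omega> (i, l)"
  shows "prob_space \<Omega>"
    and "I \<noteq> {} \<Longrightarrow> m > 0 \<Longrightarrow> prob_space.indep_vars \<Omega> (\<lambda>_. \<Pi>\<^sub>M l\<in>{..<m}. borel) \<xi> I"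
    and "i \<in> I \<Longrightarrow> \<xi> i \<in> measurable \<Omega> (\<Pi>\<^sub>M l\<in>{..<m}. borel)"
    and "i \<in> I \<Longrightarrow> distr \<Omega> (\<Pi>\<^sub>M l\<in>{..<m}. borel) (\<xi> i) = (\<Pi>\<^sub>M l\<in>{..<m}. std_normal_distribution)"
proof -
  show "prob_space \<Omega>"
    unfolding \<Omega>_def by (rule prob_space_PiM_std_normal)
  then interpret prob_space \<Omega> .
  show "random_variable (\<Pi>\<^sub>M l\<in>{..<m}. borel) (\<xi> i)" if "i \<in> I"
    unfolding \<Omega>_def \<xi>_def using that by (intro measurable_restrict) simp
  show "distr \<Omega> (\<Pi>\<^sub>M l\<in>{..<m}. borel) (\<xi> i) = (\<Pi>\<^sub>M l\<in>{..<m}. std_normal_distribution)" if "i \<in> I"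
  proof -
    \<comment> \<open>Copy \<open>i\<close> is the mixture with all its weight on \<open>i\<close>,
      so its law follows from the law of mixtures.\<close>
    have pick: "(\<Sum>j\<in>I. (if j = i then 1 else 0) * f j) = f i" for f :: "'i \<Rightarrow> real"
      using that \<open>finite I\<close> by (subst sum.remove[of _ i]) (auto intro!: sum.neutral)
    have pick2: "(\<Sum>j\<in>I. (if j = i then 1 else 0 :: real)\<^sup>2) = 1"
      using that \<open>finite I\<close> by (subst sum.remove[of _ i]) (auto intro!: sum.neutral)
    show ?thesis
      using distr_std_normal_vector_combination[OF \<open>finite I\<close> _ pick2, of "{..<m}"]
      by (simp add: \<Omega>_def \<xi>_def pick)
  qed
  assume "I \<noteq> {}" "m > 0"
  then have ne: "I \<times> {..<m} \<noteq> {}" by auto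
  have "indep_vars (\<lambda>_. \<Pi>\<^sub>M l\<in>{..<m}. borel)
     (\<lambda>i \<omega>. \<lambda>l\<in>{..<m}. restrict (\<lambda>p. \<omega> p) ({i} \<times> {..<m}) (i, l)) I"
    unfolding \<Omega>_def
    by (rule prob_space.indep_vars_compose2[OF prob_space_PiM_std_normal
              prob_space.indep_vars_restrict[OF prob_space_PiM_std_normal indep_vars_PiM_std_normal[OF ne]]])
       (auto simp: disjoint_family_on_def simp del: restrict_apply
         intro!: measurable_restrict measurable_component_singleton)
  then show "indep_vars (\<lambda>_. \<Pi>\<^sub>M l\<in>{..<m}. borel) \<xi> I"
    by (simp add: \<xi>_def cong: restrict_cong)
qed

text \<open>An index selected from \<open>Z j\<close> is independent of \<open>Z i\<close> and
  behaves like a fixed one: for each \<open>t\<close> the probability factorizes, and the selection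
  events, being disjoint, have total probability at most 1. Unlike a plain union bound this costs no
  factor \<open>card T\<close>, which is what keeps the constants independent of the policy
  class.\<close>

lemma prob_independent_selection_le:
  assumes M: "prob_space M" and ind: "prob_space.indep_vars M (\<lambda>_. N) Z I" and i: "i \<in> I" "j \<in> I" "i \<noteq> j"
    and T: "finite T" "disjoint_family_on S T"
    and sets: "\<And>t. t \<in> T \<Longrightarrow> S t \<in> sets N" "\<And>t. t \<in> T \<Longrightarrow> E t \<in> sets N"
    and c: "0 \<le> c" "\<And>t. t \<in> T \<Longrightarrow> measure M (Z i -` E t \<inter> space M) \<le> c"
  shows "measure M {\<omega> \<in> space M. \<exists>t\<in>T. Z j \<omega> \<in> S t \<and> Z i \<omega> \<in> E t} \<le> c"
proof -
  interpret prob_space M by (rule M)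
  have rv: "random_variable N (Z i)" "random_variable N (Z j)"
    using ind i by (auto simp: indep_vars_def)
  define U where "U = (\<lambda>t. (Z j -` S t \<inter> space M) \<inter> (Z i -` E t \<inter> space M))"
  have mS: "Z j -` S t \<inter> space M \<in> events" and mE: "Z i -` E t \<inter> space M \<in> events" if "t \<in> T" for t
    using that sets rv by (auto intro: measurable_sets)
  have "prob {\<omega> \<in> space M. \<exists>t\<in>T. Z j \<omega> \<in> S t \<and> Z i \<omega> \<in> E t} = prob (\<Union>t\<in>T. U t)"
    by (rule arg_cong[where f = prob]) (auto simp: U_def)
  also have "\<dots> \<le> (\<Sum>t\<in>T. prob (U t))"
    using T mS mE by (intro finite_measure_subadditive_finite) (auto simp: U_def)
  also have "\<dots> \<le> (\<Sum>t\<in>T. prob (Z j -` S t \<inter> space M) * c)"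
  proof (rule sum_mono)
    fix t assume t: "t \<in> T"
    define A where "A = (\<lambda>l. if l = j then S t else E t)"
    have "U t = (\<Inter>l\<in>{i, j}. Z l -` A l \<inter> space M)"
      using i by (auto simp: U_def A_def)
    also have "prob \<dots> = (\<Prod>l\<in>{i, j}. prob (Z l -` A l \<inter> space M))"
      using i sets t by (intro indep_varsD[OF ind]) (auto simp: A_def)
    also have "\<dots> = prob (Z j -` S t \<inter> space M) * prob (Z i -` E t \<inter> space M)"
      using i by (simp add: A_def)
    also have "\<dots> \<le> prob (Z j -` S t \<inter> space M) * c"
      using c(2)[OF t] by (intro mult_left_mono) auto
    finally show "prob (U t) \<le> prob (Z j -` S t \<inter> space M) * c" .
  qed
  also have "\<dots> = (\<Sum>t\<in>T. prob (Z j -` S t \<inter> space M)) * c"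
    by (simp add: sum_distrib_right)
  also have "(\<Sum>t\<in>T. prob (Z j -` S t \<inter> space M)) = prob (\<Union>t\<in>T. Z j -` S t \<inter> space M)"
    using T mS by (intro finite_measure_finite_Union[symmetric]) (auto simp: disjoint_family_on_def)
  also have "\<dots> * c \<le> 1 * c"
    using c(1) by (intro mult_right_mono) auto
  finally show ?thesis by simp
qed

lemma prob_all_avoid_le:
  assumes M: "prob_space M" and ind: "prob_space.indep_vars M (\<lambda>_. N) Z I" and "finite J" "J \<subseteq> I" "G \<in> sets N"
    and large: "\<And>i. i \<in> J \<Longrightarrow> \<epsilon> \<le> measure M (Z i -` G \<inter> space M)"
  shows "measure M {\<omega> \<in> space M. \<forall>i\<in>J. Z i \<omega> \<notin> G} \<le> (1 - \<epsilon>) ^ card J"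
proof (cases "J = {}")
  case True
  then show ?thesis
    using prob_space.prob_space[OF M] by simp
next
  case False
  interpret prob_space M by (rule M)
  have rv: "random_variable N (Z i)" if "i \<in> J" for i
    using ind that \<open>J \<subseteq> I\<close> by (auto simp: indep_vars_def)
  have "{\<omega> \<in> space M. \<forall>i\<in>J. Z i \<omega> \<notin> G} = (\<Inter>i\<in>J. Z i -` (space N - G) \<inter> space M)"
    using False measurable_space[OF rv] by auto
  also have "prob \<dots> = (\<Prod>i\<in>J. prob (Z i -` (space N - G) \<inter> space M))"
    using assms False by (intro indep_varsD[OF ind]) auto
  also have "\<dots> \<le> (\<Prod>i\<in>J. 1 - \<epsilon>)"
  proof (rule prod_mono)
    fix i assume i: "i \<in> J"
    have "Z i -` (space N - G) \<inter> space M = space M - (Z i -` G \<inter> space M)"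
      using measurable_space[OF rv[OF i]] by auto
    then show "0 \<le> prob (Z i -` (space N - G) \<inter> space M) \<and> prob (Z i -` (space N - G) \<inter> space M) \<le> 1 - \<epsilon>"
      using prob_compl[OF measurable_sets[OF rv[OF i] \<open>G \<in> sets N\<close>]] large[OF i] by simp
  qed
  finally show ?thesis by simp
qed

text \<open>
  There are \<open>J\<close> copies in each of \<open>K + 1\<close> blocks, so that every block is likely to have a copy that
  reaches \<open>C\<close>. The extra index \<open>(Suc K, 0)\<close> is the copy that will complete the weights to a unit vector.
\<close>

lemma copies_large_at_own_indices:
  fixes A :: "'t \<Rightarrow> nat \<Rightarrow> real" and T :: "'t set" and K J m :: nat and b C R \<epsilon> :: real
  defines "\<gamma> \<equiv> \<Pi>\<^sub>M l\<in>{..<m}. std_normal_distribution"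
    and "a \<equiv> \<lambda>t z. \<Sum>l<m. A t l * z l"
    and "N \<equiv> (K + 1) * J"
    and "I' \<equiv> insert (Suc K, 0) ({..K} \<times> {..<J})"
  defines "\<Omega> \<equiv> \<Pi>\<^sub>M p\<in>I'\<times>{..<m}. std_normal_distribution"
    and "\<xi> \<equiv> \<lambda>i (\<omega>::(nat \<times> nat) \<times> nat \<Rightarrow> real). \<lambda>l\<in>{..<m}. \<omega> (i, l)"
  assumes m: "m > 0" and T: "finite T" and var: "\<And>t. t \<in> T \<Longrightarrow> (\<Sum>l<m. (A t l)\<^sup>2) \<le> b"
    and large: "\<epsilon> \<le> measure \<gamma> {z \<in> space \<gamma>. \<exists>t\<in>T. C \<le> \<bar>a t z\<bar>}"
    and J: "J > 0" "(K + 1) * (1 - \<epsilon>) ^ J \<le> 1 / 4"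
    and R: "R > 0" "b \<ge> 0" "(real N + 1)\<^sup>2 * (b / R\<^sup>2) \<le> 1 / 4"
  obtains \<Gamma> where "\<Gamma> \<in> sets \<Omega>" "1 / 2 \<le> measure \<Omega> \<Gamma>"
    and "\<And>\<omega>. \<omega> \<in> \<Gamma> \<Longrightarrow> \<exists>ix t. \<forall>j\<le>K. ix j \<in> {j} \<times> {..<J} \<and> t j \<in> T \<and>
           C \<le> \<bar>a (t j) (\<xi> (ix j) \<omega>)\<bar> \<and> (\<forall>i\<in>I'. i \<noteq> ix j \<longrightarrow> \<bar>a (t j) (\<xi> i \<omega>)\<bar> \<le> R)"
proof -
  define I where "I = {..K} \<times> {..<J}"
  define B where "B = (\<Pi>\<^sub>M l\<in>{..<m}. borel :: real measure)"
  have I'_def': "I' = insert (Suc K, 0) I"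
    by (simp add: I'_def I_def)
  have fin: "finite I" "finite I'" "I \<subseteq> I'" "I' \<noteq> {}" and cardI': "card I' = N + 1"
    by (auto simp: I_def I'_def' N_def)
  interpret prob_space \<Omega>
    unfolding \<Omega>_def by (rule std_normal_blocks[OF fin(2)])
  have ind: "indep_vars (\<lambda>_. B) \<xi> I'"
    using std_normal_blocks(2)[OF fin(2,4) m] by (simp add: \<Omega>_def \<xi>_def B_def)
  have rv: "random_variable B (\<xi> i)" if "i \<in> I'" for i
    using std_normal_blocks(3)[OF fin(2) that, of m] by (simp add: \<Omega>_def \<xi>_def B_def)
  have law: "distr \<Omega> B (\<xi> i) = \<gamma>" if "i \<in> I'" for i
    using std_normal_blocks(4)[OF fin(2) that, of m] by (simp add: \<Omega>_def \<xi>_def B_def \<gamma>_def)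
  have \<gamma>B [measurable_cong]: "sets \<gamma> = sets B"
    unfolding \<gamma>_def B_def by (intro sets_PiM_cong) auto
  have space_\<gamma>: "space \<gamma> = space B"
    using \<gamma>B by (rule sets_eq_imp_space_eq)
  have a_meas [measurable]: "a t \<in> borel_measurable B" for t
    unfolding a_def B_def by measurable
  have prob_\<xi>: "prob (\<xi> i -` E \<inter> space \<Omega>) = measure \<gamma> E" if "i \<in> I'" "E \<in> sets B" for i E
    using that rv by (subst law[symmetric, OF that(1)]) (simp add: measure_distr)

  define P where "P = (\<lambda>t z. C \<le> \<bar>a t z\<bar>)"
  \<comment> \<open>The index is read off from one copy alone, hence independent of every other
    copy. Outside \<open>Good\<close> it is an arbitrary fixed element.\<close>
  define sel where "sel = (\<lambda>z. SOME t. t \<in> T \<and> P t z)"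
  define Good where "Good = {z \<in> space B. \<exists>t\<in>T. P t z}"
  have Good_sets: "Good \<in> sets B"
    unfolding Good_def P_def using T by measurable
  have sel: "sel z \<in> T" "C \<le> \<bar>a (sel z) z\<bar>" if "z \<in> Good" for z
  proof -
    have "\<exists>t. t \<in> T \<and> P t z" using that by (auto simp: Good_def)
    from someI_ex[OF this] show "sel z \<in> T" "C \<le> \<bar>a (sel z) z\<bar>"
      by (auto simp: sel_def P_def)
  qed

  define F where "F = (\<lambda>j. {\<omega> \<in> space \<Omega>. \<forall>i\<in>{j} \<times> {..<J}. \<xi> i \<omega> \<notin> Good})"
  define S where "S = (\<lambda>t. {z \<in> space B. sel z = t})"
  define E where "E = (\<lambda>t. {z \<in> space B. R \<le> \<bar>a t z\<bar>})"
  \<comment> \<open>\<open>H (i, j)\<close>: copy \<open>i\<close> is large at the index selected by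
    copy \<open>j\<close>. All ordered pairs are excluded, with the compensating copy among them,
    because the copy that will represent a block is not known in advance.\<close>
  define H where "H = (\<lambda>(i, j). {\<omega> \<in> space \<Omega>. \<exists>t\<in>T. \<xi> j \<omega> \<in> S t \<and> \<xi> i \<omega> \<in> E t})"
  define PP where "PP = {p \<in> I' \<times> I'. fst p \<noteq> snd p}"
  have S_sets: "S t \<in> sets B" for t
    unfolding S_def sel_def using T by (rule sets_finite_selection) (simp add: P_def)
  have E_sets: "E t \<in> sets B" for t
    unfolding E_def by measurable
  have F_sets: "F j \<in> sets \<Omega>" if "j \<le> K" for j
  proof -
    have "F j = space \<Omega> - (\<Union>i\<in>{j} \<times> {..<J}. \<xi> i -` Good \<inter> space \<Omega>)"
      by (auto simp: F_def)
    moreover have "i \<in> I'" if "i \<in> {j} \<times> {..<J}" for i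
      using that \<open>j \<le> K\<close> by (auto simp: I'_def' I_def)
    then have "(\<Union>i\<in>{j} \<times> {..<J}. \<xi> i -` Good \<inter> space \<Omega>) \<in> sets \<Omega>"
      using measurable_sets[OF rv Good_sets] by (intro sets.finite_UN) auto
    ultimately show ?thesis by auto
  qed
  have H_sets: "H p \<in> sets \<Omega>" if PPp: "p \<in> PP" for p
  proof -
    obtain i j where p: "p = (i, j)" "i \<in> I'" "j \<in> I'"
      using PPp by (cases p) (auto simp: PP_def)
    have "H p = (\<Union>t\<in>T. (\<xi> j -` S t \<inter> space \<Omega>) \<inter> (\<xi> i -` E t \<inter> space \<Omega>))"
      by (auto simp: H_def p)
    then show ?thesis
      using p T by (auto intro!: sets.finite_UN sets.Int measurable_sets[OF rv] S_sets E_sets)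
  qed
  have prob_F: "prob (F j) \<le> (1 - \<epsilon>) ^ J" if "j \<le> K" for j
  proof -
    have "prob (F j) \<le> (1 - \<epsilon>) ^ card ({j} \<times> {..<J})"
      unfolding F_def
    proof (rule prob_all_avoid_le[OF prob_space_axioms ind _ _ Good_sets])
      show sub: "{j} \<times> {..<J} \<subseteq> I'" using that by (auto simp: I'_def' I_def)
      fix i assume "i \<in> {j} \<times> {..<J}"
      with sub have "i \<in> I'" by auto
      then show "\<epsilon> \<le> prob (\<xi> i -` Good \<inter> space \<Omega>)"
        using large by (simp add: prob_\<xi> Good_sets) (simp add: Good_def P_def space_\<gamma>)
    qed auto
    then show ?thesis by (simp add: card_cartesian_product)
  qed
  have prob_H: "prob (H p) \<le> b / R\<^sup>2" if PPp: "p \<in> PP" for p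
  proof -
    obtain i j where p: "p = (i, j)" "i \<in> I'" "j \<in> I'" "i \<noteq> j"
      using PPp by (cases p) (auto simp: PP_def)
    show ?thesis
      unfolding p H_def prod.case
    proof (rule prob_independent_selection_le[OF prob_space_axioms ind p(2-4) T])
      show "disjoint_family_on S T" by (auto simp: disjoint_family_on_def S_def)
      fix t assume "t \<in> T"
      from std_normal_combination_tail[OF _ var[OF this] R(1)]
      have "measure \<gamma> (E t) \<le> b / R\<^sup>2"
        by (simp add: \<gamma>_def[symmetric] space_\<gamma> a_def E_def)
      then show "prob (\<xi> i -` E t \<inter> space \<Omega>) \<le> b / R\<^sup>2"
        using p by (simp add: prob_\<xi> E_sets)
    qed (use S_sets E_sets R in auto)
  qed

  define \<Gamma> where "\<Gamma> = space \<Omega> - ((\<Union>j\<in>{..K}. F j) \<union> (\<Union>p\<in>PP. H p))"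
  have finPP: "finite PP" using fin by (auto simp: PP_def)
  have \<Gamma>_sets: "\<Gamma> \<in> sets \<Omega>"
    unfolding \<Gamma>_def using F_sets H_sets finPP by (intro sets.Diff sets.Un sets.finite_UN) auto
  \<comment> \<open>Two failures of probability at most 1/4 each: some block has no copy reaching
    \<open>C\<close>, controlled by \<open>J\<close>, or some copy is large at an index that another
    selects, controlled by \<open>R\<close> over at most \<open>(N + 1)\<^sup>2\<close>
    pairs.\<close>
  have prob_\<Gamma>: "1 / 2 \<le> prob \<Gamma>"
  proof -
    have "prob (\<Union>j\<in>{..K}. F j) \<le> (\<Sum>j\<in>{..K}. prob (F j))"
      using F_sets by (intro finite_measure_subadditive_finite) auto
    also have "\<dots> \<le> (\<Sum>j\<in>{..K}. (1 - \<epsilon>) ^ J)"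
      using prob_F by (intro sum_mono) auto
    also have "\<dots> \<le> 1 / 4" using J by simp
    finally have 1: "prob (\<Union>j\<in>{..K}. F j) \<le> 1 / 4" .
    have "prob (\<Union>p\<in>PP. H p) \<le> (\<Sum>p\<in>PP. prob (H p))"
      using H_sets finPP by (intro finite_measure_subadditive_finite) auto
    also have "\<dots> \<le> (\<Sum>p\<in>PP. b / R\<^sup>2)"
      using prob_H by (intro sum_mono) auto
    also have "\<dots> = real (card PP) * (b / R\<^sup>2)" by simp
    also have "\<dots> \<le> (real N + 1)\<^sup>2 * (b / R\<^sup>2)"
    proof (rule mult_right_mono)
      have "card PP \<le> card (I' \<times> I')"
        unfolding PP_def using fin by (intro card_mono) auto
      also have "\<dots> = (N + 1)\<^sup>2"
        by (simp add: cardI' card_cartesian_product power2_eq_square)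
      finally show "real (card PP) \<le> (real N + 1)\<^sup>2"
        by (metis of_nat_1 of_nat_add of_nat_le_iff of_nat_power)
    qed (use R in auto)
    also have "\<dots> \<le> 1 / 4" by (rule R)
    finally have 2: "prob (\<Union>p\<in>PP. H p) \<le> 1 / 4" .
    have "prob ((\<Union>j\<in>{..K}. F j) \<union> (\<Union>p\<in>PP. H p)) \<le> prob (\<Union>j\<in>{..K}. F j) + prob (\<Union>p\<in>PP. H p)"
      using F_sets H_sets finPP by (intro measure_Un_le) auto
    moreover have "prob \<Gamma> = 1 - prob ((\<Union>j\<in>{..K}. F j) \<union> (\<Union>p\<in>PP. H p))"
      unfolding \<Gamma>_def using F_sets H_sets finPP by (intro prob_compl sets.Un sets.finite_UN) auto
    ultimately show ?thesis using 1 2 by linarith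
  qed

  have choice: "\<exists>ix t. \<forall>j\<le>K. ix j \<in> {j} \<times> {..<J} \<and> t j \<in> T \<and>
      C \<le> \<bar>a (t j) (\<xi> (ix j) \<omega>)\<bar> \<and> (\<forall>i\<in>I'. i \<noteq> ix j \<longrightarrow> \<bar>a (t j) (\<xi> i \<omega>)\<bar> \<le> R)"
    if \<omega>: "\<omega> \<in> \<Gamma>" for \<omega>
  proof -
    have \<omega>_sp: "\<omega> \<in> space \<Omega>" using \<omega> by (simp add: \<Gamma>_def)
    have "\<exists>i\<in>{j} \<times> {..<J}. \<xi> i \<omega> \<in> Good" if "j \<le> K" for j
      using \<omega> that by (auto simp: \<Gamma>_def F_def)
    then obtain ix where ix: "\<And>j. j \<le> K \<Longrightarrow> ix j \<in> {j} \<times> {..<J} \<and> \<xi> (ix j) \<omega> \<in> Good"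
      by metis
    define t where "t = (\<lambda>j. sel (\<xi> (ix j) \<omega>))"
    have ixI: "ix j \<in> I" if "j \<le> K" for j
      using ix[OF that] that by (auto simp: I_def)
    have tT: "t j \<in> T" if "j \<le> K" for j
      using sel ix[OF that] by (simp add: t_def)
    have le_R: "\<bar>a (t j) (\<xi> i \<omega>)\<bar> \<le> R" if "i \<in> I'" "j \<le> K" "i \<noteq> ix j" for i j
    proof (rule ccontr)
      assume "\<not> ?thesis"
      then have "\<xi> i \<omega> \<in> E (t j)"
        using measurable_space[OF rv[OF that(1)] \<omega>_sp] by (simp add: E_def)
      moreover have "\<xi> (ix j) \<omega> \<in> S (t j)"
        using ix[OF that(2)] by (auto simp: S_def t_def Good_def)
      ultimately have "\<omega> \<in> H (i, ix j)"
        using \<omega>_sp tT[OF that(2)] by (auto simp: H_def)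
      moreover have "(i, ix j) \<in> PP"
        using that ixI fin by (auto simp: PP_def)
      ultimately show False using \<omega> by (auto simp: \<Gamma>_def)
    qed
    have "C \<le> \<bar>a (t j) (\<xi> (ix j) \<omega>)\<bar>" if "j \<le> K" for j
      using sel ix[OF that] by (simp add: t_def)
    then show ?thesis
      using ix tT le_R by (intro exI[of _ ix] exI[of _ t]) blast
  qed
  show ?thesis
    by (rule that[OF \<Gamma>_sets prob_\<Gamma> choice])
qed

text \<open>\<open>Q\<close> values for every weight suffice for the mixture to be spread for three quarters of the choices.\<close>

lemma gaussian_tail_if_rarely_spread:
  fixes A :: "'t \<Rightarrow> nat \<Rightarrow> real" and s :: "'t \<Rightarrow> real" and T :: "'t set" and K J m :: nat
    and b C R \<epsilon> :: real
  defines "\<gamma> \<equiv> \<Pi>\<^sub>M l\<in>{..<m}. std_normal_distribution"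
    and "a \<equiv> \<lambda>t z. \<Sum>l<m. A t l * z l"
    and "N \<equiv> (K + 1) * J" and "Q \<equiv> 4 * (K + 1)\<^sup>2"
  assumes m: "m > 0" and T: "finite T" and var: "\<And>t. t \<in> T \<Longrightarrow> (\<Sum>l<m. (A t l)\<^sup>2) \<le> b"
    and sp: "measure \<gamma> {z \<in> space \<gamma>. spread K T (\<lambda>t. a t z + s t)} \<le> 1 / 4"
    and J: "J > 0" "(K + 1) * (1 - \<epsilon>) ^ J \<le> 1 / 4"
    and R: "R > 0" "b \<ge> 0" "(real N + 1)\<^sup>2 * (b / R\<^sup>2) \<le> 1 / 4"
    and C: "1 / (real Q * real N) * (C - R) \<ge> 2 * R + 2"
  shows "measure \<gamma> {z \<in> space \<gamma>. \<exists>t\<in>T. C \<le> \<bar>a t z\<bar>} < \<epsilon>"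
proof (rule ccontr)
  assume "\<not> ?thesis"
  then have large: "\<epsilon> \<le> measure \<gamma> {z \<in> space \<gamma>. \<exists>t\<in>T. C \<le> \<bar>a t z\<bar>}"
    by simp
  define I where "I = {..K} \<times> {..<J}"
  define V :: "nat \<times> nat" where "V = (Suc K, 0)"
  define I' where "I' = insert V I"
  \<comment> \<open>As \<open>q i < Q\<close>, each weight \<open>\<alpha> * q i\<close> is at most
    \<open>1 / N\<close>. The \<open>N\<close> squares then sum to at most 1, and a real weight
    remains for the compensating copy \<open>V\<close>.\<close>
  define \<alpha> where "\<alpha> = 1 / (real Q * real N)"
  define B where "B = (\<Pi>\<^sub>M l\<in>{..<m}. borel :: real measure)"
  define \<Omega> where "\<Omega> = (\<Pi>\<^sub>M p\<in>I'\<times>{..<m}. std_normal_distribution)"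
  define \<xi> where "\<xi> = (\<lambda>i (\<omega>::(nat \<times> nat) \<times> nat \<Rightarrow> real). \<lambda>l\<in>{..<m}. \<omega> (i, l))"
  have fin: "finite I" "finite I'" "I \<subseteq> I'" "I' \<noteq> {}" "V \<notin> I" "V \<in> I'" and cardI: "card I = N"
    by (auto simp: I_def I'_def V_def N_def)
  then have cardI': "card I' = N + 1"
    by (simp add: I'_def)
  have N0: "N > 0" and Q0: "Q > 0"
    using J by (auto simp: N_def Q_def)
  then have \<alpha>0: "\<alpha> > 0"
    by (simp add: \<alpha>_def)
  interpret prob_space \<Omega>
    unfolding \<Omega>_def by (rule prob_space_PiM_std_normal)
  have \<gamma>B [measurable_cong]: "sets \<gamma> = sets B"
    unfolding \<gamma>_def B_def by (intro sets_PiM_cong) auto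
  have space_\<gamma>: "space \<gamma> = space B"
    using \<gamma>B by (rule sets_eq_imp_space_eq)
  have a_meas [measurable]: "a t \<in> borel_measurable B" for t
    unfolding a_def B_def by measurable
  obtain \<Gamma> where \<Gamma>_sets: "\<Gamma> \<in> sets \<Omega>" and prob_\<Gamma>: "1 / 2 \<le> prob \<Gamma>"
    and choice: "\<And>\<omega>. \<omega> \<in> \<Gamma> \<Longrightarrow> \<exists>ix t. \<forall>j\<le>K. ix j \<in> {j} \<times> {..<J} \<and> t j \<in> T \<and>
           C \<le> \<bar>a (t j) (\<xi> (ix j) \<omega>)\<bar> \<and> (\<forall>i\<in>I'. i \<noteq> ix j \<longrightarrow> \<bar>a (t j) (\<xi> i \<omega>)\<bar> \<le> R)"
  proof (rule copies_large_at_own_indices[OF m T var large[unfolded \<gamma>_def a_def] J R[unfolded N_def]],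
      goal_cases)
    case (2 \<Gamma>)
    show ?case
      by (rule 2(1)) (use 2(2-) in \<open>simp_all add: \<Omega>_def I'_def I_def V_def \<xi>_def a_def\<close>)
  qed

  define QQ where "QQ = I \<rightarrow>\<^sub>E {..<Q}"
  define w where "w = (\<lambda>q::nat \<times> nat \<Rightarrow> nat. sqrt (1 - (\<Sum>i\<in>I. (\<alpha> * real (q i))\<^sup>2)))"
  define G where "G = (\<lambda>q \<omega> t. (\<Sum>i\<in>I. \<alpha> * real (q i) * a t (\<xi> i \<omega>)) + w q * a t (\<xi> V \<omega>) + s t)"
  define Sp where "Sp = (\<lambda>q. {\<omega> \<in> space \<Omega>. spread K T (G q \<omega>)})"
  have finQQ: "finite QQ" and cardQQ: "card QQ = Q ^ N"
    using fin cardI by (auto simp: QQ_def card_PiE intro!: finite_PiE)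
  have le1: "(\<Sum>i\<in>I. (\<alpha> * real (q i))\<^sup>2) \<le> 1" if q: "q \<in> QQ" for q
  proof -
    have "(\<Sum>i\<in>I. (\<alpha> * real (q i))\<^sup>2) \<le> (\<Sum>i\<in>I. 1 / real N)"
    proof (rule sum_mono)
      fix i assume "i \<in> I"
      then have "q i < Q" using q by (auto simp: QQ_def)
      then have "\<alpha> * real (q i) \<le> \<alpha> * real Q"
        using \<alpha>0 by (intro mult_left_mono) auto
      also have "\<dots> = 1 / real N" using Q0 by (simp add: \<alpha>_def)
      finally have "\<alpha> * real (q i) \<le> 1 / real N" .
      moreover have "1 / real N \<le> 1" using N0 by simp
      ultimately have "(\<alpha> * real (q i))\<^sup>2 \<le> (1 / real N) * 1"
        unfolding power2_eq_square using \<alpha>0 by (intro mult_mono) auto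
      then show "(\<alpha> * real (q i))\<^sup>2 \<le> 1 / real N" by simp
    qed
    also have "\<dots> = 1" using cardI N0 by simp
    finally show ?thesis .
  qed

  have Sp: "Sp q \<in> sets \<Omega> \<and> prob (Sp q) \<le> 1 / 4" if q: "q \<in> QQ" for q
  proof -
    \<comment> \<open>With \<open>w q\<close> at \<open>V\<close> the weights have unit length, so
      the mixture is distributed like one copy whatever \<open>q\<close> is. Hence the bound 1/4
      holds for every grid point.\<close>
    define W where "W = (\<lambda>i. if i = V then w q else \<alpha> * real (q i))"
    have W1: "(\<Sum>i\<in>I'. (W i)\<^sup>2) = 1"
    proof -
      have "(\<Sum>i\<in>I'. (W i)\<^sup>2) = (w q)\<^sup>2 + (\<Sum>i\<in>I. (W i)\<^sup>2)"
        using fin by (simp add: I'_def W_def)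
      also have "(\<Sum>i\<in>I. (W i)\<^sup>2) = (\<Sum>i\<in>I. (\<alpha> * real (q i))\<^sup>2)"
        using fin by (intro sum.cong) (auto simp: W_def)
      finally show ?thesis using le1[OF q] by (simp add: w_def)
    qed
    define mix where "mix = (\<lambda>\<omega>. \<lambda>l\<in>{..<m}. \<Sum>i\<in>I'. W i * \<omega> (i, l))"
    have mix: "distr \<Omega> B mix = \<gamma>"
      unfolding \<Omega>_def B_def \<gamma>_def mix_def
      by (rule distr_std_normal_vector_combination[OF fin(2) _ W1]) simp
    have mix_meas: "mix \<in> measurable \<Omega> B"
      unfolding \<Omega>_def B_def mix_def by measurable
    have "G q \<omega> t = a t (mix \<omega>) + s t" for \<omega> t
    proof -
      have "a t (mix \<omega>) = (\<Sum>i\<in>I'. W i * a t (\<xi> i \<omega>))"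
        unfolding a_def mix_def \<xi>_def
        by (simp add: sum_distrib_left sum_distrib_right mult_ac) (rule sum.swap)
      also have "\<dots> = (\<Sum>i\<in>I. W i * a t (\<xi> i \<omega>)) + w q * a t (\<xi> V \<omega>)"
        using fin by (simp add: I'_def W_def)
      also have "(\<Sum>i\<in>I. W i * a t (\<xi> i \<omega>)) = (\<Sum>i\<in>I. \<alpha> * real (q i) * a t (\<xi> i \<omega>))"
        using fin by (intro sum.cong) (auto simp: W_def)
      finally show ?thesis by (simp add: G_def)
    qed
    then have "G q \<omega> = (\<lambda>t. a t (mix \<omega>) + s t)" for \<omega>
      by (simp add: fun_eq_iff)
    then have eq: "Sp q = mix -` {z \<in> space B. spread K T (\<lambda>t. a t z + s t)} \<inter> space \<Omega>"
      using measurable_space[OF mix_meas] by (auto simp: Sp_def)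
    have meas: "{z \<in> space B. spread K T (\<lambda>t. a t z + s t)} \<in> sets B"
      using T by measurable
    have "prob (Sp q) = measure \<gamma> {z \<in> space B. spread K T (\<lambda>t. a t z + s t)}"
      unfolding eq mix[symmetric] by (rule measure_distr[symmetric, OF mix_meas]) (use meas in simp)
    then show ?thesis
      using sp measurable_sets[OF mix_meas meas] by (simp add: eq space_\<gamma>)
  qed

  have count: "3 / 4 * real (Q ^ N) \<le> (\<Sum>q\<in>QQ. indicator (Sp q) \<omega>)" if \<omega>: "\<omega> \<in> \<Gamma>" for \<omega>
  proof -
    have \<omega>_sp: "\<omega> \<in> space \<Omega>" using sets.sets_into_space[OF \<Gamma>_sets] \<omega> by auto
    obtain ix t where ix_t: "\<And>j. j \<le> K \<Longrightarrow> ix j \<in> {j} \<times> {..<J} \<and> t j \<in> T \<and>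
           C \<le> \<bar>a (t j) (\<xi> (ix j) \<omega>)\<bar> \<and> (\<forall>i\<in>I'. i \<noteq> ix j \<longrightarrow> \<bar>a (t j) (\<xi> i \<omega>)\<bar> \<le> R)"
      using choice[OF \<omega>] by blast
    have ix: "ix j \<in> {j} \<times> {..<J}" and tT: "t j \<in> T" and big: "C \<le> \<bar>a (t j) (\<xi> (ix j) \<omega>)\<bar>"
      if "j \<le> K" for j
      using ix_t[OF that] by auto
    have ixI: "ix j \<in> I" if "j \<le> K" for j
      using ix[OF that] that by (auto simp: I_def)
    have le_R: "\<bar>a (t j) (\<xi> i \<omega>)\<bar> \<le> R" if "i \<in> I'" "j \<le> K" "i \<noteq> ix j" for i j
      using ix_t[OF that(2)] that by blast
    have "card {q \<in> QQ. \<not> spread K T (\<lambda>x. (\<Sum>i\<in>I. \<alpha> * real (q i) * a x (\<xi> i \<omega>)) +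
            w q * a x (\<xi> V \<omega>) + s x)} \<le> (K + 1)\<^sup>2 * Q ^ (card I - 1)"
      unfolding w_def QQ_def
    proof (rule few_mixtures_not_spread[where ix = ix and t = t and R = R and C = C])
      show "2 * R + 2 \<le> \<alpha> * (C - R)" using C by (simp add: \<alpha>_def)
      show "(\<Sum>i\<in>I. (\<alpha> * real (q i))\<^sup>2) \<le> 1" if "q \<in> I \<rightarrow>\<^sub>E {..<Q}" for q
        using le1 that by (simp add: QQ_def)
      show "C \<le> \<bar>a (t j) (\<xi> (ix j) \<omega>)\<bar>" if "j \<le> K" for j
        by (rule big[OF that])
      show "\<bar>a (t j') (\<xi> (ix j) \<omega>)\<bar> \<le> R" if "j \<le> K" "j' \<le> K" "j \<noteq> j'" for j j'
        using ix[OF that(1)] ix[OF that(2)] that fin ixI by (intro le_R) auto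
      show "\<bar>a (t j) (\<xi> V \<omega>)\<bar> \<le> R" if "j \<le> K" for j
        using ixI[OF that] fin that by (intro le_R) auto
    qed (use fin ixI tT \<alpha>0 in auto)
    then have "card {q \<in> QQ. \<not> spread K T (G q \<omega>)} \<le> (K + 1)\<^sup>2 * Q ^ (N - 1)"
      by (simp add: G_def cardI)
    \<comment> \<open>The factor 4 in \<open>Q = 4 * (K + 1)\<^sup>2\<close> makes the exceptional
      weights at most a quarter of the grid.\<close>
    then have "4 * card {q \<in> QQ. \<not> spread K T (G q \<omega>)} \<le> Q * Q ^ (N - 1)"
      by (simp add: Q_def)
    also have "\<dots> = Q ^ N" using N0 by (metis power_minus_mult mult.commute)
    finally have "real (4 * card {q \<in> QQ. \<not> spread K T (G q \<omega>)}) \<le> real (Q ^ N)"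
      by (rule of_nat_mono)
    then have bad: "4 * real (card {q \<in> QQ. \<not> spread K T (G q \<omega>)}) \<le> real (Q ^ N)"
      by simp
    have "(\<Sum>q\<in>QQ. indicator (Sp q) \<omega>) = (\<Sum>q\<in>QQ. if spread K T (G q \<omega>) then 1 else (0::real))"
      using \<omega>_sp by (intro sum.cong) (auto simp: Sp_def indicator_def)
    also have "\<dots> = real (card {q \<in> QQ. spread K T (G q \<omega>)})"
      using finQQ by (simp add: sum.If_cases Int_def)
    finally have sum_eq: "(\<Sum>q\<in>QQ. indicator (Sp q) \<omega>) = real (card {q \<in> QQ. spread K T (G q \<omega>)})" .
    have "card QQ = card {q \<in> QQ. spread K T (G q \<omega>)} + card {q \<in> QQ. \<not> spread K T (G q \<omega>)}"
      using finQQ by (subst card_Un_disjoint[symmetric]) (auto intro!: arg_cong[where f = card])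
    then show ?thesis using bad sum_eq cardQQ by simp
  qed

  \<comment> \<open>The expected number of grid points with a spread mixture is computed in two
    ways: at least \<open>3 / 8 * Q ^ N\<close> by counting on \<open>\<Gamma>\<close>, and at most
    \<open>1 / 4 * Q ^ N\<close> point by point.\<close>
  have "3 / 4 * real (Q ^ N) * (1 / 2) \<le> 3 / 4 * real (Q ^ N) * prob \<Gamma>"
    using prob_\<Gamma> by (intro mult_left_mono) auto
  also have "\<dots> = expectation (\<lambda>\<omega>. 3 / 4 * real (Q ^ N) * indicator \<Gamma> \<omega>)"
    using \<Gamma>_sets by simp
  also have "\<dots> \<le> expectation (\<lambda>\<omega>. \<Sum>q\<in>QQ. indicator (Sp q) \<omega>)"
  proof (rule integral_mono)
    show "integrable \<Omega> (\<lambda>\<omega>. 3 / 4 * real (Q ^ N) * indicator \<Gamma> \<omega>)"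
      using \<Gamma>_sets by (intro integrable_mult_right) (simp add: emeasure_eq_measure)
    show "integrable \<Omega> (\<lambda>\<omega>. \<Sum>q\<in>QQ. indicator (Sp q) \<omega> :: real)"
      using Sp by (intro Bochner_Integration.integrable_sum) (simp add: emeasure_eq_measure)
    show "3 / 4 * real (Q ^ N) * indicator \<Gamma> \<omega> \<le> (\<Sum>q\<in>QQ. indicator (Sp q) \<omega>)" for \<omega>
      using count by (auto simp: indicator_def[of \<Gamma>] intro!: sum_nonneg)
  qed
  also have "\<dots> = (\<Sum>q\<in>QQ. prob (Sp q))"
    using Sp by (subst Bochner_Integration.integral_sum) (auto simp: emeasure_eq_measure)
  also have "\<dots> \<le> (\<Sum>q\<in>QQ. 1 / 4)"
    using Sp by (intro sum_mono) auto
  also have "\<dots> = 1 / 4 * real (Q ^ N)"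
    by (simp add: cardQQ)
  finally show False using Q0 by simp
qed

text \<open>The order of the quantifiers is the point: \<open>C\<close> is fixed before the
  dimension \<open>m\<close>, the coefficients, the shift and the index set. \<open>J\<close> is
  chosen from \<open>\<epsilon>\<close> and \<open>K\<close>, then \<open>R\<close> from
  \<open>b\<close> and the number of copies, and finally \<open>C\<close>.\<close>

lemma gaussian_uniform_tail_if_rarely_spread:
  fixes \<epsilon> b :: real and K :: nat
  assumes "\<epsilon> > 0"
  obtains C :: real where "C > 0"
    "\<And>(m::nat) (A :: 't \<Rightarrow> nat \<Rightarrow> real) (s :: 't \<Rightarrow> real) T.
       finite T \<Longrightarrow> (\<And>t. t \<in> T \<Longrightarrow> (\<Sum>l<m. (A t l)\<^sup>2) \<le> b) \<Longrightarrow>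
       measure (\<Pi>\<^sub>M l\<in>{..<m}. std_normal_distribution)
         {z \<in> space (\<Pi>\<^sub>M l\<in>{..<m}. std_normal_distribution).
            spread K T (\<lambda>t. (\<Sum>l<m. A t l * z l) + s t)} \<le> 1 / 4 \<Longrightarrow>
       measure (\<Pi>\<^sub>M l\<in>{..<m}. std_normal_distribution)
         {z \<in> space (\<Pi>\<^sub>M l\<in>{..<m}. std_normal_distribution).
            \<exists>t\<in>T. C \<le> \<bar>\<Sum>l<m. A t l * z l\<bar>} \<le> \<epsilon>"
proof -
  \<comment> \<open>Capping at 1/2 keeps \<open>1 - \<epsilon>'\<close> in \<open>[0, 1)\<close>, so
    that its powers tend to 0.\<close>
  define \<epsilon>' where "\<epsilon>' = min \<epsilon> (1 / 2)"
  have \<epsilon>': "0 < \<epsilon>'" "\<epsilon>' \<le> 1 / 2" "\<epsilon>' \<le> \<epsilon>" using assms by (auto simp: \<epsilon>'_def)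
  have "(\<lambda>J. real (K + 1) * (1 - \<epsilon>') ^ J) \<longlonglongrightarrow> real (K + 1) * 0"
    using \<epsilon>' by (intro tendsto_mult_left LIMSEQ_realpow_zero) auto
  then have "eventually (\<lambda>J. real (K + 1) * (1 - \<epsilon>') ^ J < 1 / 4) sequentially"
    by (rule order_tendstoD) simp
  then have "eventually (\<lambda>J. J > 0 \<and> real (K + 1) * (1 - \<epsilon>') ^ J < 1 / 4) sequentially"
    using eventually_gt_at_top[of "0::nat"] by eventually_elim simp
  then obtain J where J: "J > 0" "real (K + 1) * (1 - \<epsilon>') ^ J < 1 / 4"
    by (auto simp: eventually_sequentially)
  define N where "N = (K + 1) * J"
  define Q where "Q = 4 * (K + 1)\<^sup>2"
  \<comment> \<open>The sign of \<open>b\<close> is not fixed, and a square root of the bound is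
    taken next. \<open>R\<close> is such that \<open>R\<^sup>2\<close> is at least
    \<open>4 * (N + 1)\<^sup>2 * b'\<close>, with 1 added to keep it positive when
    \<open>b' = 0\<close>; \<open>C\<close> solves
    \<open>(C - R) / (Q * N) = 2 * R + 2\<close>.\<close>
  define b' where "b' = max b 0"
  define R where "R = 1 + 2 * (real N + 1) * sqrt b'"
  define C where "C = R + (2 * R + 2) * (real Q * real N)"
  have "b' \<ge> 0" by (simp add: b'_def)
  then have R: "R \<ge> 1" by (simp add: R_def)
  have "(2 * (real N + 1) * sqrt b')\<^sup>2 \<le> R\<^sup>2"
    using \<open>b' \<ge> 0\<close> by (intro power_mono) (auto simp: R_def)
  moreover have "(2 * (real N + 1) * sqrt b')\<^sup>2 = 4 * ((real N + 1)\<^sup>2 * b')"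
    unfolding power_mult_distrib real_sqrt_pow2[OF \<open>b' \<ge> 0\<close>] by simp
  ultimately have "4 * ((real N + 1)\<^sup>2 * b') \<le> R\<^sup>2" by simp
  then have R2: "(real N + 1)\<^sup>2 * (b' / R\<^sup>2) \<le> 1 / 4"
    using R by (simp add: field_simps)
  have "Q > 0" "N > 0" using J by (auto simp: N_def Q_def)
  then have NQ: "real Q * real N > 0" by simp
  then have C0: "C > 0" using R by (auto simp: C_def intro!: add_pos_nonneg)
  show ?thesis
  proof (rule that[OF C0])
    fix m and A :: "'t \<Rightarrow> nat \<Rightarrow> real" and s :: "'t \<Rightarrow> real" and T
    assume H: "finite T" "\<And>t. t \<in> T \<Longrightarrow> (\<Sum>l<m. (A t l)\<^sup>2) \<le> b"
      "measure (\<Pi>\<^sub>M l\<in>{..<m}. std_normal_distribution)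
         {z \<in> space (\<Pi>\<^sub>M l\<in>{..<m}. std_normal_distribution).
            spread K T (\<lambda>t. (\<Sum>l<m. A t l * z l) + s t)} \<le> 1 / 4"
    show "measure (\<Pi>\<^sub>M l\<in>{..<m}. std_normal_distribution)
         {z \<in> space (\<Pi>\<^sub>M l\<in>{..<m}. std_normal_distribution).
            \<exists>t\<in>T. C \<le> \<bar>\<Sum>l<m. A t l * z l\<bar>} \<le> \<epsilon>"
    proof (cases "m = 0")
      case True
      then show ?thesis using C0 assms by simp
    next
      case False
      have "measure (\<Pi>\<^sub>M l\<in>{..<m}. std_normal_distribution)
         {z \<in> space (\<Pi>\<^sub>M l\<in>{..<m}. std_normal_distribution).
            \<exists>t\<in>T. C \<le> \<bar>\<Sum>l<m. A t l * z l\<bar>} < \<epsilon>'"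
      proof (rule gaussian_tail_if_rarely_spread[where K = K and J = J and R = R and b = b' and s = s])
        show "(\<Sum>l<m. (A t l)\<^sup>2) \<le> b'" if "t \<in> T" for t
          using H(2)[OF that] by (simp add: b'_def)
        show "(real ((K + 1) * J) + 1)\<^sup>2 * (b' / R\<^sup>2) \<le> 1 / 4"
          using R2 by (simp only: N_def)
        show "2 * R + 2 \<le> 1 / (real (4 * (K + 1)\<^sup>2) * real ((K + 1) * J)) * (C - R)"
          using NQ \<open>Q > 0\<close> \<open>N > 0\<close> unfolding Q_def[symmetric] N_def[symmetric] by (simp add: C_def)
      qed (use False H J R \<open>b' \<ge> 0\<close> in auto)
      then show ?thesis using \<epsilon>' by linarith
    qed
  qed
qed

section \<open>Bounded-Lipschitz distance and Borel laws on metric spaces\<close>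

lemma openin_mtopology_of_subset: "{U. openin (mtopology_of m) U} \<subseteq> Pow (mspace m)"
  using openin_subset[of "mtopology_of m"] by auto

lemma sets_metric_borel_openin:
  "openin (mtopology_of m) U \<Longrightarrow> U \<in> sets (metric_borel m)"
  using openin_mtopology_of_subset[of m] by (auto simp: metric_borel_def)

lemma space_metric_borel: "space (metric_borel m) = mspace m"
  using openin_mtopology_of_subset[of m] by (simp add: metric_borel_def space_measure_of)

lemma sets_metric_borel_closedin:
  "closedin (mtopology_of m) U \<Longrightarrow> U \<in> sets (metric_borel m)"
  using sets_metric_borel_openin[of m "mspace m - U"] sets.compl_sets[of "mspace m - U" "metric_borel m"]
  by (auto simp: space_metric_borel closedin_def double_diff)

lemma openin_lipschitz_vimage:
  fixes h :: "'a \<Rightarrow> real"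
  assumes "\<And>x y. x \<in> mspace m \<Longrightarrow> y \<in> mspace m \<Longrightarrow> \<bar>h x - h y\<bar> \<le> mdist m x y" "open U"
  shows "openin (mtopology_of m) {x \<in> mspace m. h x \<in> U}"
proof -
  have "Lipschitz_continuous_map m euclidean_metric h"
    unfolding Lipschitz_continuous_map_def
    using assms(1) by (auto simp: dist_real_def intro!: exI[of _ 1])
  then have "continuous_map (mtopology_of m) euclidean h"
    using Lipschitz_continuous_imp_continuous_map by fastforce
  then show ?thesis
    using assms(2) by (simp add: continuous_map_def)
qed

lemma lipschitz_borel_measurable:
  fixes h :: "'a \<Rightarrow> real"
  assumes "\<And>x y. x \<in> mspace m \<Longrightarrow> y \<in> mspace m \<Longrightarrow> \<bar>h x - h y\<bar> \<le> mdist m x y"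
  shows "h \<in> borel_measurable (metric_borel m)"
proof (rule borel_measurableI)
  fix U :: "real set" assume "open U"
  have "h -` U \<inter> space (metric_borel m) = {x \<in> mspace m. h x \<in> U}"
    by (auto simp: space_metric_borel)
  then show "h -` U \<inter> space (metric_borel m) \<in> sets (metric_borel m)"
    using openin_lipschitz_vimage[OF assms \<open>open U\<close>] by (simp add: sets_metric_borel_openin)
qed

section \<open>Lipschitz functions for the supremum distance\<close>

lemma linf_abs_diff_le:
  fixes f g :: "'i \<Rightarrow> real"
  assumes "f \<in> mspace (linf S)" "g \<in> mspace (linf S)" "t \<in> S"
  shows "\<bar>f t - g t\<bar> \<le> mdist (linf S) f g"
  using funspace_mdist_le[OF assms(1,2), of "mdist (linf S) f g"] assms(3)
  by (auto simp: dist_real_def)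

lemma zero_in_linf: "(\<lambda>t\<in>S. 0::real) \<in> mspace (linf S)"
proof -
  have "bounded ((\<lambda>t\<in>S. 0::real) ` S)"
    by (rule bounded_subset[of "{0}"]) auto
  then show ?thesis
    by (simp add: Metric_space.fspace_def[OF Metric_space_mspace_mdist, of euclidean_metric, simplified])
qed

lemma lipschitz_mdist:
  assumes "x \<in> mspace m" "y \<in> mspace m" "z \<in> mspace m"
  shows "\<bar>mdist m x z - mdist m y z\<bar> \<le> mdist m x y"
proof -
  interpret Metric_space "mspace m" "mdist m" by simp
  show ?thesis
    using triangle[OF assms(1,2,3)] triangle[OF assms(2,1,3)] commute[of x y] by linarith
qed

text \<open>The distance to a set supplies the test function that vanishes on few-valued
  processes.\<close>

lemma lipschitz_INF_mdist:
  assumes "Y \<subseteq> mspace m" "Y \<noteq> {}" "x \<in> mspace m" "x' \<in> mspace m"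
  shows "\<bar>(INF y\<in>Y. mdist m x y) - (INF y\<in>Y. mdist m x' y)\<bar> \<le> mdist m x x'"
proof -
  interpret Metric_space "mspace m" "mdist m" by simp
  have "(INF y\<in>Y. mdist m x y) - mdist m x x' \<le> (INF y\<in>Y. mdist m x' y)"
    if x: "x \<in> mspace m" "x' \<in> mspace m" for x x'
  proof (rule cINF_greatest[OF assms(2)])
    fix y assume y: "y \<in> Y"
    have "bdd_below (mdist m x ` Y)" by (rule bdd_belowI[of _ 0]) auto
    then have "(INF y\<in>Y. mdist m x y) \<le> mdist m x y"
      using y by (rule cINF_lower)
    also have "\<dots> \<le> mdist m x x' + mdist m x' y"
      using triangle[of x x' y] x y assms(1) by auto
    finally show "(INF y\<in>Y. mdist m x y) - mdist m x x' \<le> mdist m x' y" by simp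
  qed
  from this[OF assms(3,4)] this[OF assms(4,3)] show ?thesis
    using commute[of x x'] by linarith
qed

lemma INF_mdist_nonneg: "Y \<noteq> {} \<Longrightarrow> 0 \<le> (INF y\<in>Y. mdist m x y)"
  by (intro cINF_greatest) auto

section \<open>Outer expectations and integrals of Lipschitz test functions\<close>

lemma BL1_integrable:
  assumes "prob_space M" and M: "sets M = sets (metric_borel m)" and h: "h \<in> BL1 m"
  shows "integrable M h"
proof -
  interpret prob_space M by fact
  have "h \<in> borel_measurable (metric_borel m)"
    using h by (intro lipschitz_borel_measurable) (auto simp: BL1_def)
  then have "h \<in> borel_measurable M"
    using M by (simp cong: measurable_cong_sets)
  moreover have "AE x in M. norm (h x) \<le> 1"
    using h sets_eq_imp_space_eq[OF M] by (auto simp: BL1_def space_metric_borel)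
  ultimately show ?thesis
    by (intro integrable_const_bound[where B = 1])
qed

text \<open>The constant \<open>c\<close> is an admissible majorant, and every majorant lies above
  \<open>- c\<close>. The last two claims are the side conditions under which a real
  \<open>Inf\<close> can be compared with its members; without them its value carries no
  information.\<close>

lemma outer_expectation_bounds:
  assumes M: "prob_space M" and f: "\<And>x. x \<in> space M \<Longrightarrow> \<bar>f x\<bar> \<le> c"
  shows "\<bar>outer_expectation M f\<bar> \<le> c"
    and "bdd_below {(\<integral>x. u x \<partial>M) | u. integrable M u \<and> (\<forall>x\<in>space M. f x \<le> u x)}"
    and "{(\<integral>x. u x \<partial>M) | u. integrable M u \<and> (\<forall>x\<in>space M. f x \<le> u x)} \<noteq> {}"
proof -
  interpret prob_space M by (rule M)
  let ?A = "{(\<integral>x. u x \<partial>M) | u. integrable M u \<and> (\<forall>x\<in>space M. f x \<le> u x)}"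
  have "\<forall>x\<in>space M. f x \<le> c"
    using f by (auto simp: abs_le_iff)
  then have c_in: "c \<in> ?A"
    by (auto intro!: exI[of _ "\<lambda>_. c"] simp: prob_space)
  then show "?A \<noteq> {}" by blast
  have low: "- c \<le> a" if a: "a \<in> ?A" for a
  proof -
    obtain u where u: "a = (\<integral>x. u x \<partial>M)" "integrable M u" "\<And>x. x \<in> space M \<Longrightarrow> f x \<le> u x"
      using a by auto
    have "- c \<le> u x" if "x \<in> space M" for x
      using f[OF that] u(3)[OF that] by linarith
    then have "(\<integral>x. - c \<partial>M) \<le> (\<integral>x. u x \<partial>M)"
      using u(2) by (intro integral_mono) auto
    then show ?thesis by (simp add: u prob_space)
  qed
  then show bdd: "bdd_below ?A" by (rule bdd_belowI)
  show "\<bar>outer_expectation M f\<bar> \<le> c"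
    using cInf_lower[OF c_in bdd] cInf_greatest[OF \<open>?A \<noteq> {}\<close> low]
    unfolding outer_expectation_def by linarith
qed

lemma BL_distance_ge:
  assumes "prob_space M" "prob_space \<mu>" "sets \<mu> = sets (metric_borel m)"
    and "\<And>d. d \<in> space M \<Longrightarrow> Y d \<in> mspace m" "h \<in> BL1 m"
  shows "\<bar>outer_expectation M (\<lambda>d. h (Y d)) - (\<integral>f. h f \<partial>\<mu>)\<bar> \<le> BL_distance m M Y \<mu>"
  unfolding BL_distance_def
proof (rule cSUP_upper[OF assms(5)])
  interpret M: prob_space M by fact
  interpret mu: prob_space \<mu> by fact
  \<comment> \<open>A real supremum dominates its members only over a bounded family. Here 2 is a
    bound, since the outer expectation and the integral are each at most 1 in absolute
    value.\<close>
  show "bdd_above ((\<lambda>h. \<bar>outer_expectation M (\<lambda>d. h (Y d)) - (\<integral>f. h f \<partial>\<mu>)\<bar>) ` BL1 m)"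
  proof (rule bdd_aboveI2[where M = 2])
    fix h assume h: "h \<in> BL1 m"
    have "\<bar>outer_expectation M (\<lambda>d. h (Y d))\<bar> \<le> 1"
      using h assms(4) by (intro outer_expectation_bounds[OF assms(1)]) (auto simp: BL1_def)
    moreover have "\<bar>\<integral>f. h f \<partial>\<mu>\<bar> \<le> 1"
    proof -
      have "\<bar>\<integral>f. h f \<partial>\<mu>\<bar> \<le> (\<integral>f. \<bar>h f\<bar> \<partial>\<mu>)" by simp
      also have "\<dots> \<le> (\<integral>f. 1 \<partial>\<mu>)"
        using BL1_integrable[OF assms(2,3) h] h sets_eq_imp_space_eq[OF assms(3)]
        by (intro integral_mono) (auto simp: BL1_def space_metric_borel)
      finally show ?thesis by (simp add: mu.prob_space)
    qed
    ultimately show "\<bar>outer_expectation M (\<lambda>d. h (Y d)) - (\<integral>f. h f \<partial>\<mu>)\<bar> \<le> 2" by linarith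
  qed
qed

section \<open>Uniform tightness of the recentered processes\<close>

lemma gaussian_process_law_space:
  assumes "gaussian_process_law S \<Sigma> \<mu>"
  shows "space \<mu> = mspace (linf S)"
  using assms sets_eq_imp_space_eq[of \<mu> "metric_borel (linf S)"]
  by (simp add: gaussian_process_law_def space_metric_borel del: mspace_funspace)

lemma gaussian_process_law_lipschitz_measurable:
  fixes h :: "('i \<Rightarrow> real) \<Rightarrow> real"
  assumes "gaussian_process_law S \<Sigma> \<mu>"
    and "\<And>x y. x \<in> mspace (linf S) \<Longrightarrow> y \<in> mspace (linf S) \<Longrightarrow> \<bar>h x - h y\<bar> \<le> mdist (linf S) x y"
  shows "h \<in> borel_measurable \<mu>"
  using lipschitz_borel_measurable[of "linf S" h] assms
  by (simp add: gaussian_process_law_def cong: measurable_cong_sets)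

lemma gaussian_process_law_eval_measurable:
  assumes "gaussian_process_law S \<Sigma> \<mu>" "t \<in> S"
  shows "(\<lambda>f. f t) \<in> borel_measurable \<mu>"
  using linf_abs_diff_le[of _ S _ t] assms(2)
  by (intro gaussian_process_law_lipschitz_measurable[OF assms(1)]) blast

text \<open>The bridge from the law on bounded functions to finite Gaussian vectors. On the
  diagonal, the factorization of the covariance says that the variance is the squared length of a
  row of \<open>A\<close>.\<close>

lemma gaussian_process_law_marginal:
  assumes "gaussian_process_law S \<Sigma> \<mu>" "finite T" "T \<subseteq> S"
  obtains m :: nat and A where "\<And>t. t \<in> T \<Longrightarrow> \<Sigma> t t = (\<Sum>l<m. (A t l)\<^sup>2)"
    and "\<And>B. B \<in> sets (\<Pi>\<^sub>M t\<in>T. borel) \<Longrightarrow>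
           measure \<mu> {f \<in> space \<mu>. restrict f T \<in> B} =
           measure (\<Pi>\<^sub>M l\<in>{..<m}. std_normal_distribution)
             {z \<in> space (\<Pi>\<^sub>M l\<in>{..<m}. std_normal_distribution). (\<lambda>t\<in>T. \<Sum>l<m. A t l * z l) \<in> B}"
proof -
  obtain m :: nat and A where cov: "\<And>s t. s \<in> T \<Longrightarrow> t \<in> T \<Longrightarrow> \<Sigma> s t = (\<Sum>l<m. A s l * A t l)"
    and law: "distr \<mu> (\<Pi>\<^sub>M t\<in>T. borel) (\<lambda>f. restrict f T) =
      distr (\<Pi>\<^sub>M l\<in>{..<m}. std_normal_distribution) (\<Pi>\<^sub>M t\<in>T. borel) (\<lambda>z. \<lambda>t\<in>T. \<Sum>l<m. A t l * z l)"
  proof -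
    have "\<forall>T. finite T \<and> T \<subseteq> S \<longrightarrow>
        (\<exists>(m::nat) A.
           (\<forall>s\<in>T. \<forall>t\<in>T. \<Sigma> s t = (\<Sum>l<m. A s l * A t l)) \<and>
           distr \<mu> (\<Pi>\<^sub>M t\<in>T. borel) (\<lambda>f. restrict f T) =
             distr (\<Pi>\<^sub>M l\<in>{..<m}. std_normal_distribution) (\<Pi>\<^sub>M t\<in>T. borel)
               (\<lambda>z. \<lambda>t\<in>T. \<Sum>l<m. A t l * z l))"
      using assms(1) unfolding gaussian_process_law_def by (elim conjE)
    from this[rule_format, OF conjI[OF assms(2,3)]] show thesis
      using that by (elim exE conjE) blast
  qed
  have m1: "(\<lambda>f. restrict f T) \<in> measurable \<mu> (\<Pi>\<^sub>M t\<in>T. borel)"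
    using gaussian_process_law_eval_measurable[OF assms(1)] assms(3) by (intro measurable_restrict) auto
  have m2: "(\<lambda>z. \<lambda>t\<in>T. \<Sum>l<m. A t l * z l) \<in>
      measurable (\<Pi>\<^sub>M l\<in>{..<m}. std_normal_distribution) (\<Pi>\<^sub>M t\<in>T. borel)"
    by (intro measurable_restrict) measurable
  show ?thesis
  proof (rule that[of A m])
    show "\<Sigma> t t = (\<Sum>l<m. (A t l)\<^sup>2)" if "t \<in> T" for t
      using cov[OF that that] by (simp add: power2_eq_square)
    fix B :: "('a \<Rightarrow> real) set" assume B: "B \<in> sets (\<Pi>\<^sub>M t\<in>T. borel)"
    from arg_cong[OF law, of "\<lambda>M. measure M B"]
    show "measure \<mu> {f \<in> space \<mu>. restrict f T \<in> B} =
           measure (\<Pi>\<^sub>M l\<in>{..<m}. std_normal_distribution)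
             {z \<in> space (\<Pi>\<^sub>M l\<in>{..<m}. std_normal_distribution). (\<lambda>t\<in>T. \<Sum>l<m. A t l * z l) \<in> B}"
      by (simp add: measure_distr[OF m1 B] measure_distr[OF m2 B] vimage_def Int_def conj_commute)
  qed
qed

text \<open>Tightness supplies the compact set that reduces the supremum over \<open>S\<close> to finite subsets,
  although \<open>S\<close> may be uncountable.\<close>

lemma gaussian_process_law_norm_tail:
  assumes gp: "gaussian_process_law S \<Sigma> \<mu>" and "S \<noteq> {}" "\<epsilon> > 0"
    and fin: "\<And>T. finite T \<Longrightarrow> T \<subseteq> S \<Longrightarrow> measure \<mu> {f \<in> space \<mu>. \<exists>t\<in>T. C \<le> \<bar>f t\<bar>} \<le> \<epsilon>"
  shows "measure \<mu> {f \<in> space \<mu>. C + 1 \<le> mdist (linf S) f (\<lambda>t\<in>S. 0)} \<le> 2 * \<epsilon>"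
proof -
  define m where "m = linf S"
  define z where "z = (\<lambda>t\<in>S. 0::real)"
  define D where "D = {f \<in> mspace m. C + 1 \<le> mdist m f z}"
  have z: "z \<in> mspace m" unfolding z_def m_def by (rule zero_in_linf)
  have sp: "space \<mu> = mspace m" using gaussian_process_law_space[OF gp] by (simp add: m_def)
  have st: "sets \<mu> = sets (metric_borel m)" using gp by (simp add: gaussian_process_law_def m_def)
  interpret prob_space \<mu> using gp by (simp add: gaussian_process_law_def)
  interpret ms: Metric_space "mspace m" "mdist m" by simp
  obtain Kc where Kc: "compactin (mtopology_of m) Kc" "measure \<mu> (space \<mu> - Kc) < \<epsilon>"
    using gp \<open>\<epsilon> > 0\<close> unfolding gaussian_process_law_def tight_on_def m_def by blast
  have "Hausdorff_space (mtopology_of m)"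
    using ms.Hausdorff_space_mtopology by (simp add: mtopology_of_def)
  then have "Kc \<in> sets \<mu>"
    using Kc compactin_imp_closedin sets_metric_borel_closedin st by blast
  \<comment> \<open>A norm above \<open>C\<close> forces \<open>\<bar>f t\<bar> > C\<close> for some
    \<open>t\<close>, so these open sets cover \<open>D\<close>. The set \<open>D\<close> itself
    asks for \<open>C + 1\<close> with a weak inequality, which makes it closed and
    \<open>D \<inter> Kc\<close> compact.\<close>
  define O' where "O' = (\<lambda>t. {f \<in> mspace m. f t \<in> - {-C..C}})"
  have O_open: "openin (mtopology_of m) (O' t)" if "t \<in> S" for t
    unfolding O'_def m_def
    by (rule openin_lipschitz_vimage) (use that linf_abs_diff_le in \<open>auto simp del: mspace_funspace mdist_funspace\<close>)
  have "openin (mtopology_of m) {f \<in> mspace m. mdist m f z \<in> {..<C + 1}}"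
    by (rule openin_lipschitz_vimage) (use z lipschitz_mdist in auto)
  then have D_closed: "closedin (mtopology_of m) D"
    by (auto simp: closedin_def D_def Diff_eq not_le elim!: back_subst[of "openin _"])
  have "D \<inter> Kc \<subseteq> \<Union> (O' ` S)"
  proof safe
    fix f assume f: "f \<in> D" "f \<in> Kc"
    then have "\<not> mdist m f z \<le> C" and fm: "f \<in> mspace m" by (auto simp: D_def)
    then obtain t where t: "t \<in> S" "\<not> dist (f t) (z t) \<le> C"
      using funspace_mdist_le[of f S euclidean_metric z C] z \<open>S \<noteq> {}\<close> by (auto simp: m_def simp del: mspace_funspace mdist_funspace)
    then have "f \<in> O' t" using fm by (auto simp: O'_def z_def dist_real_def)
    then show "f \<in> \<Union> (O' ` S)" using t by blast
  qed
  moreover have "compactin (mtopology_of m) (D \<inter> Kc)"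
    using Kc(1) D_closed by (rule closed_Int_compactin[rotated])
  ultimately obtain \<F> where \<F>: "finite \<F>" "\<F> \<subseteq> O' ` S" "D \<inter> Kc \<subseteq> \<Union> \<F>"
    unfolding compactin_def using O_open by (metis (no_types, lifting) imageE)
  then obtain T where T: "finite T" "T \<subseteq> S" "\<F> = O' ` T"
    by (meson finite_subset_image)
  define E where "E = {f \<in> space \<mu>. \<exists>t\<in>T. C \<le> \<bar>f t\<bar>}"
  have E_sets: "E \<in> sets \<mu>"
  proof -
    have [measurable]: "(\<lambda>f. f t) \<in> borel_measurable \<mu>" if "t \<in> T" for t
      using gaussian_process_law_eval_measurable[OF gp subsetD[OF T(2) that]] .
    show ?thesis unfolding E_def using T(1) by measurable
  qed
  have "D \<subseteq> E \<union> (space \<mu> - Kc)"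
  proof
    fix f assume f: "f \<in> D"
    show "f \<in> E \<union> (space \<mu> - Kc)"
    proof (cases "f \<in> Kc")
      case True
      then obtain t where "t \<in> T" "f \<in> O' t"
        using f \<F>(3) T(3) by auto
      moreover from this have "C \<le> \<bar>f t\<bar>" by (auto simp: O'_def)
      ultimately show ?thesis by (auto simp: E_def O'_def sp)
    qed (use f in \<open>auto simp: D_def sp\<close>)
  qed
  then have "prob D \<le> prob (E \<union> (space \<mu> - Kc))"
    using E_sets \<open>Kc \<in> sets \<mu>\<close> by (intro finite_measure_mono) auto
  also have "\<dots> \<le> prob E + prob (space \<mu> - Kc)"
    using E_sets \<open>Kc \<in> sets \<mu>\<close> by (intro measure_Un_le) auto
  also have "\<dots> \<le> 2 * \<epsilon>"
    using Kc(2) fin[OF T(1,2)] by (simp add: E_def)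
  finally show ?thesis
    by (simp add: D_def sp m_def z_def del: mspace_funspace mdist_funspace)
qed

text \<open>Among \<open>K + 1\<close> indices two share a value of \<open>y + s\<close>. As
  \<open>f\<close> is within 1/2 of \<open>y\<close> at both, the values of \<open>f + s\<close>
  there are less than 1 apart.\<close>

lemma not_spread_near_few_valued:
  fixes f y s :: "'i \<Rightarrow> real"
  assumes "f \<in> mspace (linf S)" "y \<in> mspace (linf S)" "mdist (linf S) f y < 1 / 2"
    and "finite ((\<lambda>t. y t + s t) ` S)" "card ((\<lambda>t. y t + s t) ` S) \<le> K" "T \<subseteq> S"
  shows "\<not> spread K T (\<lambda>t. f t + s t)"
proof
  assume "spread K T (\<lambda>t. f t + s t)"
  then obtain \<tau> where \<tau>: "\<tau> \<in> {..K} \<rightarrow>\<^sub>E T"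
    and sep: "\<And>i j. i \<le> K \<Longrightarrow> j \<le> K \<Longrightarrow> i \<noteq> j \<Longrightarrow> 1 \<le> \<bar>(f (\<tau> i) + s (\<tau> i)) - (f (\<tau> j) + s (\<tau> j))\<bar>"
    unfolding spread_def by auto
  have \<tau>S: "\<tau> i \<in> S" if "i \<le> K" for i
    using PiE_mem[OF \<tau>, of i] that assms(6) by auto
  have "(\<lambda>i. y (\<tau> i) + s (\<tau> i)) ` {..K} \<subseteq> (\<lambda>t. y t + s t) ` S"
    using \<tau>S by auto
  then have "card ((\<lambda>i. y (\<tau> i) + s (\<tau> i)) ` {..K}) \<le> K"
    using card_mono[OF assms(4)] assms(5) by (meson le_trans)
  then have "card ((\<lambda>i. y (\<tau> i) + s (\<tau> i)) ` {..K}) < card {..K}"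
    by simp
  then have "\<not> inj_on (\<lambda>i. y (\<tau> i) + s (\<tau> i)) {..K}"
    by (rule pigeonhole)
  then obtain i j where ij: "i \<le> K" "j \<le> K" "i \<noteq> j" "y (\<tau> i) + s (\<tau> i) = y (\<tau> j) + s (\<tau> j)"
    by (auto simp: inj_on_def)
  have "\<bar>f (\<tau> i) - y (\<tau> i)\<bar> < 1 / 2" "\<bar>f (\<tau> j) - y (\<tau> j)\<bar> < 1 / 2"
    using linf_abs_diff_le[OF assms(1,2) \<tau>S] ij assms(3) by (meson le_less_trans)+
  then show False
    using sep[OF ij(1-3)] ij(4) by linarith
qed

text \<open>The test function is the distance to the functions that are few-valued after the shift,
  cut off at 1. It vanishes along \<open>Y\<close>, so its Gaussian integral is at most the
  bounded-Lipschitz distance 1/8. Spreading forces it to be at least 1/2, and Markov's inequality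
  gives 1/4.\<close>

lemma gaussian_law_rarely_spread:
  fixes s :: "'i \<Rightarrow> real"
  assumes gp: "gaussian_process_law S \<Sigma> \<mu>" and M: "prob_space M"
    and Y: "\<And>d. d \<in> space M \<Longrightarrow> Y d \<in> mspace (linf S)"
    and few: "\<And>d. d \<in> space M \<Longrightarrow>
      finite ((\<lambda>t. Y d t + s t) ` S) \<and> card ((\<lambda>t. Y d t + s t) ` S) \<le> K"
    and BL: "BL_distance (linf S) M Y \<mu> \<le> 1 / 8"
    and T: "finite T" "T \<subseteq> S"
  shows "measure \<mu> {f \<in> space \<mu>. spread K T (\<lambda>t. f t + s t)} \<le> 1 / 4"
proof -
  define m where "m = linf S"
  define F where "F = {y \<in> mspace m. finite ((\<lambda>t. y t + s t) ` S) \<and> card ((\<lambda>t. y t + s t) ` S) \<le> K}"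
  define h where "h = (\<lambda>f. min 1 (INF y\<in>F. mdist m f y))"
  interpret M: prob_space M by (rule M)
  interpret prob_space \<mu> using gp by (simp add: gaussian_process_law_def)
  have sp: "space \<mu> = mspace m" using gaussian_process_law_space[OF gp] by (simp add: m_def)
  have st: "sets \<mu> = sets (metric_borel m)" using gp by (simp add: gaussian_process_law_def m_def)
  have YF: "Y d \<in> F" if "d \<in> space M" for d
    using Y[OF that] few[OF that] by (simp add: F_def m_def)
  have F: "F \<noteq> {}" "F \<subseteq> mspace m"
    using M.not_empty YF by (auto simp: F_def)
  have h0: "0 \<le> h f" for f using INF_mdist_nonneg[OF F(1)] by (simp add: h_def)
  have h_BL1: "h \<in> BL1 m"
    using lipschitz_INF_mdist[OF F(2,1)] h0 by (fastforce simp: BL1_def h_def min_def)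
  have hY: "h (Y d) = 0" if "d \<in> space M" for d
  proof -
    have "bdd_below (mdist m (Y d) ` F)" by (rule bdd_belowI[of _ 0]) auto
    then have "(INF y\<in>F. mdist m (Y d) y) \<le> mdist m (Y d) (Y d)"
      using YF[OF that] by (rule cINF_lower)
    also have "\<dots> = 0" using YF[OF that] F(2) by auto
    finally show ?thesis using h0[of "Y d"] by (simp add: h_def)
  qed
  have "outer_expectation M (\<lambda>d. h (Y d)) = 0"
    using outer_expectation_bounds(1)[OF M, of "\<lambda>d. h (Y d)" 0] hY by simp
  with BL_distance_ge[OF M prob_space_axioms st, of Y h] Y h_BL1 BL
  have int_h: "(\<integral>f. h f \<partial>\<mu>) \<le> 1 / 8"
    by (simp add: m_def del: mspace_funspace)
  have h_int: "integrable \<mu> h" by (rule BL1_integrable[OF prob_space_axioms st h_BL1])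
  have "{f \<in> space \<mu>. spread K T (\<lambda>t. f t + s t)} \<subseteq> {f \<in> space \<mu>. 1 / 2 \<le> h f}"
  proof safe
    fix f assume f: "f \<in> space \<mu>" "spread K T (\<lambda>t. f t + s t)"
    show "1 / 2 \<le> h f"
    proof (rule ccontr)
      assume "\<not> 1 / 2 \<le> h f"
      then have "(INF y\<in>F. mdist m f y) < 1 / 2" by (simp add: h_def)
      then obtain y where y: "y \<in> F" "mdist m f y < 1 / 2"
        using cInf_lessD[of "mdist m f ` F" "1 / 2"] F(1) by auto
      have "\<not> spread K T (\<lambda>t. f t + s t)"
        by (rule not_spread_near_few_valued[of f S y])
           (use f y T(2) sp in \<open>auto simp: F_def m_def simp del: mspace_funspace mdist_funspace\<close>)
      then show False using f by simp
    qed
  qed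
  then have "measure \<mu> {f \<in> space \<mu>. spread K T (\<lambda>t. f t + s t)} \<le> measure \<mu> {f \<in> space \<mu>. 1 / 2 \<le> h f}"
    using borel_measurable_integrable[OF h_int] by (intro finite_measure_mono) auto
  also have "\<dots> \<le> (\<integral>f. h f \<partial>\<mu>) / (1 / 2)"
    using h_int h0 by (intro integral_Markov_inequality_measure[where A = "space \<mu>"]) auto
  also have "\<dots> \<le> 1 / 4" using int_h by simp
  finally show ?thesis .
qed

text \<open>The indicator of a large norm is replaced by a Lipschitz ramp that climbs from 0 at
  \<open>C\<close> to 1 at \<open>C + 1\<close>; this costs one unit in the threshold. One
  measurable set then covers the large deviations at all indices simultaneously.\<close>

lemma BL_distance_transfer_tail:
  assumes gp: "gaussian_process_law S \<Sigma> \<mu>" and M: "prob_space M" and "\<epsilon> > 0"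
    and Y: "\<And>d. d \<in> space M \<Longrightarrow> Y d \<in> mspace (linf S)"
    and BL: "BL_distance (linf S) M Y \<mu> \<le> \<epsilon>"
    and tail: "measure \<mu> {f \<in> space \<mu>. C \<le> mdist (linf S) f (\<lambda>t\<in>S. 0)} \<le> 2 * \<epsilon>"
  obtains E where "E \<in> sets M" "measure M E \<le> 4 * \<epsilon>"
    and "\<And>d t. d \<in> space M \<Longrightarrow> t \<in> S \<Longrightarrow> C + 1 \<le> \<bar>Y d t\<bar> \<Longrightarrow> d \<in> E"
proof -
  define m where "m = linf S"
  define z where "z = (\<lambda>t\<in>S. 0::real)"
  define h where "h = (\<lambda>f. min 1 (max 0 (mdist m f z - C)))"
  interpret M: prob_space M by (rule M)
  interpret prob_space \<mu> using gp by (simp add: gaussian_process_law_def)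
  have z: "z \<in> mspace m" unfolding z_def m_def by (rule zero_in_linf)
  have sp: "space \<mu> = mspace m" using gaussian_process_law_space[OF gp] by (simp add: m_def)
  have st: "sets \<mu> = sets (metric_borel m)" using gp by (simp add: gaussian_process_law_def m_def)
  have h_BL1: "h \<in> BL1 m"
    using lipschitz_mdist[of _ m _ z] z by (fastforce simp: BL1_def h_def min_def max_def)
  have h01: "0 \<le> h f" "h f \<le> 1" for f by (auto simp: h_def)
  have h_int: "integrable \<mu> h" by (rule BL1_integrable[OF prob_space_axioms st h_BL1])
  have meas: "{f \<in> space \<mu>. C \<le> mdist m f z} \<in> sets \<mu>"
  proof -
    have "(\<lambda>f. mdist m f z) \<in> borel_measurable \<mu>"
      unfolding m_def
      by (rule gaussian_process_law_lipschitz_measurable[OF gp])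
         (use z lipschitz_mdist in \<open>auto simp: m_def simp del: mspace_funspace mdist_funspace\<close>)
    then show ?thesis by measurable
  qed
  have "(\<integral>f. h f \<partial>\<mu>) \<le> (\<integral>f. indicator {f \<in> space \<mu>. C \<le> mdist m f z} f \<partial>\<mu>)"
  proof (rule integral_mono[OF h_int])
    show "integrable \<mu> (indicator {f \<in> space \<mu>. C \<le> mdist m f z} :: _ \<Rightarrow> real)"
      using meas by (simp add: emeasure_eq_measure)
    show "h f \<le> indicator {f \<in> space \<mu>. C \<le> mdist m f z} f" if "f \<in> space \<mu>" for f
      using that by (auto simp: h_def indicator_def)
  qed
  also have "\<dots> \<le> 2 * \<epsilon>"
    using tail meas by (simp add: m_def z_def del: mspace_funspace mdist_funspace)
  finally have "(\<integral>f. h f \<partial>\<mu>) \<le> 2 * \<epsilon>" .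
  moreover have "\<bar>outer_expectation M (\<lambda>d. h (Y d)) - (\<integral>f. h f \<partial>\<mu>)\<bar> \<le> \<epsilon>"
    using BL_distance_ge[OF M prob_space_axioms st, of Y h] Y h_BL1 BL by (simp add: m_def del: mspace_funspace)
  \<comment> \<open>The bound obtained is \<open>3 * \<epsilon>\<close>. Strictness is what allows
    an integrable majorant \<open>u\<close> with integral below \<open>4 * \<epsilon>\<close> to be
    taken from the infimum.\<close>
  ultimately have "outer_expectation M (\<lambda>d. h (Y d)) < 4 * \<epsilon>"
    using \<open>\<epsilon> > 0\<close> by linarith
  moreover have "\<bar>h (Y d)\<bar> \<le> 1" for d using h01[of "Y d"] by simp
  ultimately obtain u where u: "integrable M u" "\<And>d. d \<in> space M \<Longrightarrow> h (Y d) \<le> u d"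
      "(\<integral>d. u d \<partial>M) < 4 * \<epsilon>"
    using cInf_lessD[OF outer_expectation_bounds(3)[OF M, of "\<lambda>d. h (Y d)" 1], of "4 * \<epsilon>"]
    unfolding outer_expectation_def by auto
  have u0: "0 \<le> u d" if "d \<in> space M" for d
    using u(2)[OF that] h01[of "Y d"] by linarith
  \<comment> \<open>A level set of the majorant is measurable, whereas the event of a large supremum
    need not be.\<close>
  define E where "E = {d \<in> space M. 1 \<le> u d}"
  show ?thesis
  proof (rule that[of E])
    show "E \<in> sets M" unfolding E_def using borel_measurable_integrable[OF u(1)] by measurable
    have "measure M E \<le> (\<integral>d. u d \<partial>M) / 1"
      unfolding E_def using u(1) u0
      by (intro integral_Markov_inequality_measure[where A = "space M"]) auto
    then show "measure M E \<le> 4 * \<epsilon>" using u(3) by simp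
    fix d t assume d: "d \<in> space M" "t \<in> S" "C + 1 \<le> \<bar>Y d t\<bar>"
    have "\<bar>Y d t - z t\<bar> \<le> mdist m (Y d) z"
      using linf_abs_diff_le[of "Y d" S z t] Y[OF d(1)] z d(2) by (simp add: m_def del: mspace_funspace mdist_funspace)
    then have "h (Y d) = 1" using d by (simp add: h_def z_def)
    then show "d \<in> E" using u(2)[OF d(1)] d(1) by (simp add: E_def)
  qed
qed

section \<open>The trade-off rule\<close>

text \<open>With the data fixed, the value depends on the policy only through the subset of
  observations that it treats.\<close>

lemma sample_value_finitely_many:
  assumes "\<And>g i. g \<in> \<G> \<Longrightarrow> i < n \<Longrightarrow> g (X n i d) \<in> {0, 1}"
  shows "finite (sample_value e X n d ` \<G>) \<and> card (sample_value e X n d ` \<G>) \<le> 2 ^ n"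
proof -
  define v where "v = (\<lambda>B. (\<Sum>i\<in>B. e n i d) / real n)"
  have "sample_value e X n d ` \<G> \<subseteq> v ` Pow {..<n}"
  proof (rule image_subsetI)
    fix g assume g: "g \<in> \<G>"
    have "(\<Sum>i<n. e n i d * g (X n i d)) = (\<Sum>i\<in>{i. i < n \<and> g (X n i d) = 1}. e n i d)"
      using assms[OF g] by (intro sum.mono_neutral_cong_right) auto
    then have "sample_value e X n d g = v {i. i < n \<and> g (X n i d) = 1}"
      by (simp add: sample_value_def v_def)
    then show "sample_value e X n d g \<in> v ` Pow {..<n}" by auto
  qed
  moreover have "card (v ` Pow {..<n}) \<le> 2 ^ n"
    using card_image_le[of "Pow {..<n}" v] by (simp add: card_Pow)
  ultimately show ?thesis
    by (meson card_mono finite_Pow_iff finite_imageI finite_lessThan finite_subset le_trans)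
qed

text \<open>The positive part is 1-Lipschitz, so the estimated and population objectives differ by
  at most \<open>(1 + a) * c\<close>. This error is paid once at \<open>ghat\<close> and once at
  \<open>gstar\<close>, whose population penalty is zero by feasibility.\<close>

lemma tradeoff_oracle_inequality:
  fixes W Wn B Bn :: "'g \<Rightarrow> real"
  assumes pos: "a \<ge> 0"
    and ghat: "is_arg_max (\<lambda>g. Wn g - a * max (Bn g - k) 0) (\<lambda>g. g \<in> \<G>) ghat"
    and gstar: "gstar \<in> \<G>" "B gstar \<le> k"
    and W: "\<And>g. g \<in> \<G> \<Longrightarrow> \<bar>Wn g - W g\<bar> \<le> c" and B: "\<And>g. g \<in> \<G> \<Longrightarrow> \<bar>Bn g - B g\<bar> \<le> c"
  shows "a * max (B ghat - k) 0 \<le> W ghat - W gstar + 2 * (1 + a) * c"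
proof -
  have gh: "ghat \<in> \<G>"
    and max: "Wn gstar - a * max (Bn gstar - k) 0 \<le> Wn ghat - a * max (Bn ghat - k) 0"
    using ghat gstar by (auto simp: is_arg_max_def not_less)
  have "max (Bn gstar - k) 0 \<le> c" "max (B ghat - k) 0 \<le> max (Bn ghat - k) 0 + c"
    using B[OF gstar(1)] B[OF gh] gstar(2) by auto
  from this[THEN mult_left_mono, OF pos] show ?thesis
    using max W[OF gstar(1)] W[OF gh] by (simp add: algebra_simps)
qed

section \<open>Uniform convergence of outer measures by measurable covers\<close>

lemma tendsto_0_ennrealI:
  fixes f :: "'a \<Rightarrow> ennreal"
  assumes "\<And>e::real. e > 0 \<Longrightarrow> eventually (\<lambda>x. f x \<le> ennreal e) F"
  shows "(f \<longlongrightarrow> 0) F"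
proof (rule order_tendstoI)
  fix a :: ennreal assume "0 < a"
  then obtain y where y: "0 < y" "y < a" using dense by blast
  then obtain e where "y = ennreal e" "e > 0"
    by (cases y) (auto simp: top_unique)
  then show "eventually (\<lambda>x. f x < a) F"
    using assms[of e] y by (auto elim: eventually_mono)
qed simp

lemma unif_prob_nullI:
  fixes Pn :: "'p::finite dgp \<Rightarrow> nat \<Rightarrow> 'd measure"
  assumes "\<And>P n. P \<in> \<P> \<Longrightarrow> prob_space (Pn P n)"
    and "\<And>e::real. e > 0 \<Longrightarrow> \<forall>\<^sub>F n in sequentially. \<forall>P\<in>\<P>. \<exists>E\<in>sets (Pn P n).
           measure (Pn P n) E \<le> e \<and> {d \<in> space (Pn P n). Ev P n d} \<subseteq> E"
  shows "unif_prob_null \<P> Pn Ev"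
  unfolding unif_prob_null_def
proof (rule tendsto_0_ennrealI)
  fix e :: real assume "e > 0"
  from assms(2)[OF this]
  show "\<forall>\<^sub>F n in sequentially. (SUP P\<in>\<P>. outer_measure_of (Pn P n) {d \<in> space (Pn P n). Ev P n d}) \<le> ennreal e"
  proof eventually_elim
    case (elim n)
    show ?case
    proof (rule SUP_least)
      fix P assume P: "P \<in> \<P>"
      interpret prob_space "Pn P n" using assms(1)[OF P] .
      obtain E where E: "E \<in> sets (Pn P n)" "measure (Pn P n) E \<le> e"
        "{d \<in> space (Pn P n). Ev P n d} \<subseteq> E"
        using elim P by blast
      have "outer_measure_of (Pn P n) {d \<in> space (Pn P n). Ev P n d} \<le> outer_measure_of (Pn P n) E"
        using E(3) by (rule outer_measure_of_mono)
      also have "\<dots> = ennreal (measure (Pn P n) E)"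
        using E(1) by (simp add: emeasure_eq_measure)
      also have "\<dots> \<le> ennreal e" using E(2) by (rule ennreal_leI)
      finally show "outer_measure_of (Pn P n) {d \<in> space (Pn P n). Ev P n d} \<le> ennreal e" .
    qed
  qed
qed

theorem theorem4p1:
  fixes \<X> :: "(real ^ 'p::finite) set"
    and \<G> :: "'p policy set"
    and \<P> :: "'p dgp set"
    and Pn :: "'p dgp \<Rightarrow> nat \<Rightarrow> 'd measure"
    and X :: "nat \<Rightarrow> nat \<Rightarrow> 'd \<Rightarrow> real ^ 'p"
    and \<tau>est Cest :: "nat \<Rightarrow> nat \<Rightarrow> 'd \<Rightarrow> real"
    and k lam r :: real
    and gstar :: "'p dgp \<Rightarrow> 'p policy"
    and ghat :: "nat \<Rightarrow> 'd \<Rightarrow> 'p policy"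
  assumes "lam > 0" and "r > 0"
    and "policy_class \<X> \<G>"
    and "\<And>P. P \<in> \<P> \<Longrightarrow> data_distribution \<X> \<G> P"
    and "\<And>P. P \<in> \<P> \<Longrightarrow> sampling \<X> Pn X \<tau>est Cest P"
    and "estimation_quality \<G> \<P> Pn X \<tau>est Cest"
    and "\<And>P. P \<in> \<P> \<Longrightarrow>
           is_arg_max (\<lambda>g. welfare g P) (\<lambda>g. g \<in> \<G> \<and> budget g P \<le> k) (gstar P)"
    and "\<And>P n d. P \<in> \<P> \<Longrightarrow> d \<in> space (Pn P n) \<Longrightarrow>
           is_arg_max (tradeoff_objective lam r k \<tau>est Cest X n d) (\<lambda>g. g \<in> \<G>) (ghat n d)"
  shows "(\<forall>\<epsilon>>0.
            (\<lambda>n. SUP P\<in>\<P>. outer_measure_of (Pn P n)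
               {d \<in> space (Pn P n). welfare (ghat n d) P - welfare (gstar P) P < - \<epsilon>}) \<longlonglongrightarrow> 0) \<and>
         (\<forall>\<delta>. exceeds_root_n \<delta> \<longrightarrow>
            (\<lambda>n. SUP P\<in>\<P>. outer_measure_of (Pn P n)
               {d \<in> space (Pn P n). \<not> max (budget (ghat n d) P - k) 0
                  \<le> r * (welfare (ghat n d) P - welfare (gstar P) P) / lam + \<delta> n}) \<longlonglongrightarrow> 0)"
proof (cases "\<P> = {}")
  \<comment> \<open>In \<open>ennreal\<close> the supremum of the empty family is
    \<open>bot\<close>, that is 0. In the other case some \<open>gstar P\<close> exists, which shows
    that \<open>\<G>\<close> is nonempty.\<close>
  case True
  then show ?thesis by (simp add: bot_ennreal)
next
  case False
  note lam = assms(1) and r = assms(2) and samp = assms(5) and gstar = assms(7) and ghat = assms(8)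
  have gstar_in: "gstar P \<in> \<G>" "budget (gstar P) P \<le> k" if "P \<in> \<P>" for P
    using gstar[OF that] by (auto simp: is_arg_max_def)
  then have ne: "\<G> \<noteq> {}" using False by auto
  have Pn: "prob_space (Pn P n)" if "P \<in> \<P>" for P n
    using samp[OF that] by (simp add: sampling_def)
  \<comment> \<open>Policies are known to be binary only on \<open>\<X>\<close>. Measurability into
    the restricted space places the covariates there at every sample point, not merely almost
    surely.\<close>
  have X_in: "X n i d \<in> \<X>" if "P \<in> \<P>" "d \<in> space (Pn P n)" "i < n" for P n i d
  proof -
    interpret prob_space "Pn P n" using Pn[OF that(1)] .
    have "indep_vars (\<lambda>_. restrict_space borel \<X>) (X n) {..<n}"
      using samp[OF that(1)] by (simp add: sampling_def)
    then have "random_variable (restrict_space borel \<X>) (X n i)"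
      using that(3) by (simp add: indep_vars_def)
    from measurable_space[OF this that(2)] show ?thesis
      by (simp add: space_restrict_space)
  qed
  have g01: "g x \<in> {0, 1}" if "g \<in> \<G>" "x \<in> \<X>" for g x
    using assms(3) that unfolding policy_class_def by blast
  have few: "\<exists>K. \<forall>P\<in>\<P>. \<forall>d\<in>space (Pn P n).
      finite (sample_value e X n d ` \<G>) \<and> card (sample_value e X n d ` \<G>) \<le> K" for e n
    using sample_value_finitely_many[of \<G> n X _ e] g01 X_in by (intro exI[of _ "2 ^ n"]) blast
  \<comment> \<open>Kept generic in \<open>est\<close> and \<open>target\<close> to serve both
    welfare and budget. The constant \<open>C\<close> comes before \<open>n\<close> and
    \<open>P\<close>.\<close>
  have unif_tight: "\<exists>C. \<forall>\<^sub>F n in sequentially. \<forall>P\<in>\<P>. \<exists>E\<in>sets (Pn P n). measure (Pn P n) E \<le> \<epsilon> \<and>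
      (\<forall>d\<in>space (Pn P n). \<forall>g\<in>\<G>. C \<le> \<bar>sqrt (real n) * (est n d g - target g P)\<bar> \<longrightarrow> d \<in> E)"
    if lim: "unif_gaussian_limit \<G> \<P> Pn est target \<Sigma> G" and \<epsilon>: "\<epsilon> > 0"
      and var: "\<And>P g. P \<in> \<P> \<Longrightarrow> g \<in> \<G> \<Longrightarrow> \<Sigma> P g g \<le> b"
      and few: "\<And>n. \<exists>K. \<forall>P\<in>\<P>. \<forall>d\<in>space (Pn P n).
        finite (est n d ` \<G>) \<and> card (est n d ` \<G>) \<le> K"
    for est :: "nat \<Rightarrow> 'd \<Rightarrow> 'p policy \<Rightarrow> real" and target \<Sigma> G and \<epsilon> b :: real
  proof -
    let ?BL = "\<lambda>n P. BL_distance (linf \<G>) (Pn P n) (recentered \<G> est target P n) (G P)"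
    have Y: "recentered \<G> est target P n d \<in> mspace (linf \<G>)" if "P \<in> \<P>" "d \<in> space (Pn P n)" for P n d
      using lim that unfolding unif_gaussian_limit_def by blast
    have gp: "gaussian_process_law \<G> (\<Sigma> P) (G P)" if "P \<in> \<P>" for P
      using lim that unfolding unif_gaussian_limit_def by blast
    have ul: "uniform_limit \<P> ?BL (\<lambda>_. 0) sequentially"
      using lim unfolding unif_gaussian_limit_def by blast
    have BL_le: "\<forall>\<^sub>F n in sequentially. \<forall>P\<in>\<P>. ?BL n P \<le> e" if "e > 0" for e
      using uniform_limitD[OF ul that] by eventually_elim (auto simp: dist_real_def)
    \<comment> \<open>One sample size, common to all of \<open>\<P>\<close>, already constrains
      every Gaussian limit. Freezing it turns the bound on the number of values, which grows with
      \<open>n\<close>, into a constant.\<close>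
    have "\<exists>n. \<forall>P\<in>\<P>. ?BL n P \<le> 1 / 8"
      using eventually_happens[OF BL_le[of "1 / 8"]] by simp
    then obtain n0 where n0: "\<And>P. P \<in> \<P> \<Longrightarrow> ?BL n0 P \<le> 1 / 8" by blast
    obtain K where K: "\<And>P d. P \<in> \<P> \<Longrightarrow> d \<in> space (Pn P n0) \<Longrightarrow>
        finite (est n0 d ` \<G>) \<and> card (est n0 d ` \<G>) \<le> K"
      using few[of n0] by blast
    \<comment> \<open>\<open>C\<close> depends on \<open>\<epsilon>\<close>, \<open>b\<close> and
      \<open>K\<close> only, hence not on \<open>P\<close>. The quarter of \<open>\<epsilon>\<close>
      is doubled by the passage to the supremum norm, and the transfer back to the sample ends at
      \<open>4 * (\<epsilon> / 4)\<close>.\<close>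
    obtain C where "C > 0" and C: "\<And>(m::nat) (A :: 'p policy \<Rightarrow> nat \<Rightarrow> real) (s :: 'p policy \<Rightarrow> real) T.
         finite T \<Longrightarrow> (\<And>t. t \<in> T \<Longrightarrow> (\<Sum>l<m. (A t l)\<^sup>2) \<le> b) \<Longrightarrow>
         measure (\<Pi>\<^sub>M l\<in>{..<m}. std_normal_distribution)
           {z \<in> space (\<Pi>\<^sub>M l\<in>{..<m}. std_normal_distribution).
              spread K T (\<lambda>t. (\<Sum>l<m. A t l * z l) + s t)} \<le> 1 / 4 \<Longrightarrow>
         measure (\<Pi>\<^sub>M l\<in>{..<m}. std_normal_distribution)
           {z \<in> space (\<Pi>\<^sub>M l\<in>{..<m}. std_normal_distribution).
              \<exists>t\<in>T. C \<le> \<bar>\<Sum>l<m. A t l * z l\<bar>} \<le> \<epsilon> / 4"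
    proof (rule gaussian_uniform_tail_if_rarely_spread
        [where \<epsilon> = "\<epsilon> / 4" and b = b and K = K and 't = "'p policy"], goal_cases)
      case 1
      show ?case using \<epsilon> by simp
    next
      case (2 C)
      show ?case by (rule 2(1)[OF 2(2,3)])
    qed
    have tail: "measure (G P) {f \<in> space (G P). C + 1 \<le> mdist (linf \<G>) f (\<lambda>t\<in>\<G>. 0)} \<le> 2 * (\<epsilon> / 4)"
      if P: "P \<in> \<P>" for P
    proof (rule gaussian_process_law_norm_tail[OF gp[OF P] ne])
      fix T assume T: "finite T" "T \<subseteq> \<G>"
      obtain m :: nat and A where A: "\<And>t. t \<in> T \<Longrightarrow> \<Sigma> P t t = (\<Sum>l<m. (A t l)\<^sup>2)"
        and law: "\<And>B. B \<in> sets (\<Pi>\<^sub>M t\<in>T. borel) \<Longrightarrow>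
             measure (G P) {f \<in> space (G P). restrict f T \<in> B} =
             measure (\<Pi>\<^sub>M l\<in>{..<m}. std_normal_distribution)
               {z \<in> space (\<Pi>\<^sub>M l\<in>{..<m}. std_normal_distribution). (\<lambda>t\<in>T. \<Sum>l<m. A t l * z l) \<in> B}"
      proof (rule gaussian_process_law_marginal[OF gp[OF P] T], goal_cases)
        case (1 A m)
        show ?case by (rule 1(1)[OF 1(2,3)])
      qed
      \<comment> \<open>Events that look only at the coordinates in \<open>T\<close> can be
        evaluated without restricting the function to \<open>T\<close>.\<close>
      have law': "measure (G P) {f \<in> space (G P). Q f} =
             measure (\<Pi>\<^sub>M l\<in>{..<m}. std_normal_distribution)
               {z \<in> space (\<Pi>\<^sub>M l\<in>{..<m}. std_normal_distribution). Q (\<lambda>t. \<Sum>l<m. A t l * z l)}"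
        if cong: "\<And>f f'. (\<And>t. t \<in> T \<Longrightarrow> f t = f' t) \<Longrightarrow> Q f = Q f'"
          and Q: "Measurable.pred (\<Pi>\<^sub>M t\<in>T. borel) Q" for Q
      proof -
        have "{f \<in> space (\<Pi>\<^sub>M t\<in>T. borel). Q f} \<in> sets (\<Pi>\<^sub>M t\<in>T. borel)"
          using Q by measurable
        from law[OF this] cong[of "restrict _ T"] show ?thesis
          by (simp add: space_PiM)
      qed
      \<comment> \<open>Adding \<open>s\<close> cancels the population values and leaves
        \<open>sqrt n0\<close> times the estimate, which takes at most \<open>K\<close>
        values.\<close>
      define s where "s = (\<lambda>g. sqrt (real n0) * target g P)"
      have "measure (G P) {f \<in> space (G P). spread K T (\<lambda>t. f t + s t)} \<le> 1 / 4"
      proof (rule gaussian_law_rarely_spread[OF gp[OF P] Pn[OF P] Y[OF P] _ n0[OF P] T])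
        fix d assume d: "d \<in> space (Pn P n0)"
        have "(\<lambda>t. recentered \<G> est target P n0 d t + s t) ` \<G> = (\<lambda>x. sqrt (real n0) * x) ` est n0 d ` \<G>"
          unfolding image_image by (intro image_cong) (auto simp: recentered_def s_def algebra_simps)
        then show "finite ((\<lambda>t. recentered \<G> est target P n0 d t + s t) ` \<G>) \<and>
            card ((\<lambda>t. recentered \<G> est target P n0 d t + s t) ` \<G>) \<le> K"
          using K[OF P d] by (auto intro: order_trans[OF card_image_le])
      qed
      also have "measure (G P) {f \<in> space (G P). spread K T (\<lambda>t. f t + s t)} =
          measure (\<Pi>\<^sub>M l\<in>{..<m}. std_normal_distribution)
           {z \<in> space (\<Pi>\<^sub>M l\<in>{..<m}. std_normal_distribution).
              spread K T (\<lambda>t. (\<Sum>l<m. A t l * z l) + s t)}"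
      proof (rule law')
        show "spread K T (\<lambda>t. f t + s t) = spread K T (\<lambda>t. f' t + s t)"
          if "\<And>t. t \<in> T \<Longrightarrow> f t = f' t" for f f'
          unfolding spread_def using that by (intro bex_cong refl) (auto simp: PiE_iff)
        show "Measurable.pred (\<Pi>\<^sub>M t\<in>T. borel) (\<lambda>f. spread K T (\<lambda>t. f t + s t))"
          using T(1) by (intro spread_sets) auto
      qed
      finally have "measure (\<Pi>\<^sub>M l\<in>{..<m}. std_normal_distribution)
           {z \<in> space (\<Pi>\<^sub>M l\<in>{..<m}. std_normal_distribution).
              \<exists>t\<in>T. C \<le> \<bar>\<Sum>l<m. A t l * z l\<bar>} \<le> \<epsilon> / 4"
        using var[OF P] T A by (intro C[OF T(1)]) (auto simp flip: A)
      moreover have "measure (G P) {f \<in> space (G P). \<exists>t\<in>T. C \<le> \<bar>f t\<bar>} =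
          measure (\<Pi>\<^sub>M l\<in>{..<m}. std_normal_distribution)
           {z \<in> space (\<Pi>\<^sub>M l\<in>{..<m}. std_normal_distribution). \<exists>t\<in>T. C \<le> \<bar>\<Sum>l<m. A t l * z l\<bar>}"
      proof (rule law')
        show "Measurable.pred (\<Pi>\<^sub>M t\<in>T. borel) (\<lambda>f. \<exists>t\<in>T. C \<le> \<bar>f t\<bar>)"
          using T(1) by measurable
      qed auto
      ultimately show "measure (G P) {f \<in> space (G P). \<exists>t\<in>T. C \<le> \<bar>f t\<bar>} \<le> \<epsilon> / 4" by simp
    qed (use \<epsilon> in simp)
    show ?thesis
    \<comment> \<open>One unit is lost in passing from finite subsets to the whole class, the other
      on the Lipschitz ramp.\<close>
    proof (rule exI[of _ "C + 2"])
      have "\<forall>\<^sub>F n in sequentially. \<forall>P\<in>\<P>. ?BL n P \<le> \<epsilon> / 4"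
        using \<epsilon> by (intro BL_le) simp
      then show "\<forall>\<^sub>F n in sequentially. \<forall>P\<in>\<P>. \<exists>E\<in>sets (Pn P n). measure (Pn P n) E \<le> \<epsilon> \<and>
        (\<forall>d\<in>space (Pn P n). \<forall>g\<in>\<G>. C + 2 \<le> \<bar>sqrt (real n) * (est n d g - target g P)\<bar> \<longrightarrow> d \<in> E)"
      proof eventually_elim
        case (elim n)
        show ?case
        proof
          fix P assume P: "P \<in> \<P>"
          obtain E where "E \<in> sets (Pn P n)" "measure (Pn P n) E \<le> 4 * (\<epsilon> / 4)"
            and E: "\<And>d g. d \<in> space (Pn P n) \<Longrightarrow> g \<in> \<G> \<Longrightarrow>
              C + 1 + 1 \<le> \<bar>recentered \<G> est target P n d g\<bar> \<Longrightarrow> d \<in> E"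
          proof (rule BL_distance_transfer_tail[where M = "Pn P n" and \<mu> = "G P" and S = \<G>
                and Y = "recentered \<G> est target P n" and C = "C + 1" and \<epsilon> = "\<epsilon> / 4"
                and \<Sigma> = "\<Sigma> P"], goal_cases)
            case (7 E)
            show ?case by (rule 7(1)[OF 7(2-4)])
          qed (use gp Pn Y tail elim P \<epsilon> in \<open>auto simp del: mspace_funspace mdist_funspace\<close>)
          moreover have "d \<in> E" if "d \<in> space (Pn P n)" "g \<in> \<G>"
              "C + 2 \<le> \<bar>sqrt (real n) * (est n d g - target g P)\<bar>" for d g
            using that by (intro E[of d g]) (auto simp: recentered_def)
          ultimately show "\<exists>E\<in>sets (Pn P n). measure (Pn P n) E \<le> \<epsilon> \<and>
            (\<forall>d\<in>space (Pn P n). \<forall>g\<in>\<G>. C + 2 \<le> \<bar>sqrt (real n) * (est n d g - target g P)\<bar> \<longrightarrow> d \<in> E)"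
            by auto
        qed
      qed
    qed
  qed

  obtain \<Sigma>W \<Sigma>B GW GB where
      limW: "unif_gaussian_limit \<G> \<P> Pn (sample_value \<tau>est X) welfare \<Sigma>W GW" and
      limB: "unif_gaussian_limit \<G> \<P> Pn (sample_value Cest X) budget \<Sigma>B GB" and
      "unif_regular_cov \<G> \<P> \<Sigma>W" "unif_regular_cov \<G> \<P> \<Sigma>B"
    using assms(6) unfolding estimation_quality_def by blast
  then obtain bW bB where var: "\<And>P g. P \<in> \<P> \<Longrightarrow> g \<in> \<G> \<Longrightarrow> \<Sigma>W P g g \<le> bW"
      "\<And>P g. P \<in> \<P> \<Longrightarrow> g \<in> \<G> \<Longrightarrow> \<Sigma>B P g g \<le> bB"
    unfolding unif_regular_cov_def by (meson abs_le_D1)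

  define L where "L = 2 * (1 + lam / r)"
  \<comment> \<open>The oracle inequality with weight \<open>lam / r\<close> and error
    \<open>C / sqrt n\<close>; both claims are read off from it.\<close>
  define good where "good = (\<lambda>C P n d. lam / r * max (budget (ghat n d) P - k) 0
      \<le> welfare (ghat n d) P - welfare (gstar P) P + L * (C / sqrt (real n)))"
  \<comment> \<open>The threshold \<open>C\<close> may have to grow as the allowed probability
    \<open>e\<close> shrinks, so an event must eventually be excluded by \<open>good C\<close> for
    every \<open>C\<close>.\<close>
  have null: "unif_prob_null \<P> Pn Ev"
    if Ev: "\<And>C. \<forall>\<^sub>F n in sequentially. \<forall>P\<in>\<P>. \<forall>d\<in>space (Pn P n). good C P n d \<longrightarrow> \<not> Ev P n d" for Ev
  proof (rule unif_prob_nullI[OF Pn])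
    fix e :: real assume "e > 0"
    then have e2: "e / 2 > 0" by simp
    obtain CW where CW: "\<forall>\<^sub>F n in sequentially. \<forall>P\<in>\<P>. \<exists>E\<in>sets (Pn P n). measure (Pn P n) E \<le> e / 2 \<and>
        (\<forall>d\<in>space (Pn P n). \<forall>g\<in>\<G>.
           CW \<le> \<bar>sqrt (real n) * (sample_value \<tau>est X n d g - welfare g P)\<bar> \<longrightarrow> d \<in> E)"
      by (rule exE[OF unif_tight[OF limW e2 var(1) few]])
    obtain CB where CB: "\<forall>\<^sub>F n in sequentially. \<forall>P\<in>\<P>. \<exists>E\<in>sets (Pn P n). measure (Pn P n) E \<le> e / 2 \<and>
        (\<forall>d\<in>space (Pn P n). \<forall>g\<in>\<G>.
           CB \<le> \<bar>sqrt (real n) * (sample_value Cest X n d g - budget g P)\<bar> \<longrightarrow> d \<in> E)"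
      by (rule exE[OF unif_tight[OF limB e2 var(2) few]])
    define C where "C = max CW CB"
    show "\<forall>\<^sub>F n in sequentially. \<forall>P\<in>\<P>. \<exists>E\<in>sets (Pn P n).
           measure (Pn P n) E \<le> e \<and> {d \<in> space (Pn P n). Ev P n d} \<subseteq> E"
      using CW CB Ev[of C] eventually_gt_at_top[of "0::nat"]
    proof eventually_elim
      case (elim n)
      show ?case
      proof
        fix P assume P: "P \<in> \<P>"
        interpret prob_space "Pn P n" using Pn[OF P] .
        obtain EW where EW: "EW \<in> events" "prob EW \<le> e / 2"
          "\<forall>d\<in>space (Pn P n). \<forall>g\<in>\<G>.
             CW \<le> \<bar>sqrt (real n) * (sample_value \<tau>est X n d g - welfare g P)\<bar> \<longrightarrow> d \<in> EW"
          using bspec[OF elim(1) P] by (elim bexE conjE) (rule that)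
        obtain EB where EB: "EB \<in> events" "prob EB \<le> e / 2"
          "\<forall>d\<in>space (Pn P n). \<forall>g\<in>\<G>.
             CB \<le> \<bar>sqrt (real n) * (sample_value Cest X n d g - budget g P)\<bar> \<longrightarrow> d \<in> EB"
          using bspec[OF elim(2) P] by (elim bexE conjE) (rule that)
        have scale: "\<bar>y\<bar> \<le> C / sqrt (real n)" if "\<not> c \<le> \<bar>sqrt (real n) * y\<bar>" "c \<le> C" for c y :: real
          using that elim(4) by (simp add: abs_mult field_simps)
        have "{d \<in> space (Pn P n). Ev P n d} \<subseteq> EW \<union> EB"
        proof safe
          fix d assume d: "d \<in> space (Pn P n)" "Ev P n d" "d \<notin> EB"
          show "d \<in> EW"
          proof (rule ccontr)
            assume "d \<notin> EW"
            have "good C P n d"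
              unfolding good_def L_def
            proof (rule tradeoff_oracle_inequality[where Wn = "sample_value \<tau>est X n d"
                  and Bn = "sample_value Cest X n d" and W = "\<lambda>g. welfare g P"
                  and B = "\<lambda>g. budget g P" and \<G> = \<G>])
              show "0 \<le> lam / r" using lam r by simp
              show "gstar P \<in> \<G>" "budget (gstar P) P \<le> k" by (fact gstar_in[OF P])+
              show "is_arg_max (\<lambda>g. sample_value \<tau>est X n d g - lam / r * max (sample_value Cest X n d g - k) 0)
                      (\<lambda>g. g \<in> \<G>) (ghat n d)"
                using ghat[OF P d(1)] by (simp add: tradeoff_objective_def is_arg_max_def)
              show "\<bar>sample_value \<tau>est X n d g - welfare g P\<bar> \<le> C / sqrt (real n)" if "g \<in> \<G>" for g
                using EW(3)[rule_format, OF d(1) that] \<open>d \<notin> EW\<close> by (intro scale[of CW]) (auto simp: C_def)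
              show "\<bar>sample_value Cest X n d g - budget g P\<bar> \<le> C / sqrt (real n)" if "g \<in> \<G>" for g
                using EB(3)[rule_format, OF d(1) that] \<open>d \<notin> EB\<close> by (intro scale[of CB]) (auto simp: C_def)
            qed
            then show False using elim(3) P d by blast
          qed
        qed
        moreover have "prob (EW \<union> EB) \<le> e"
          using measure_Un_le[OF EW(1) EB(1)] EW(2) EB(2) by linarith
        ultimately show "\<exists>E\<in>events. prob E \<le> e \<and> {d \<in> space (Pn P n). Ev P n d} \<subseteq> E"
          using EW(1) EB(1) by blast
      qed
    qed
  qed

  have welfare_null: "unif_prob_null \<P> Pn (\<lambda>P n d. welfare (ghat n d) P - welfare (gstar P) P < - \<epsilon>)"
    if "\<epsilon> > 0" for \<epsilon>
  proof (rule null)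
    fix C
    \<comment> \<open>The penalty is nonnegative, so on \<open>good\<close> the welfare loss is at
      most this vanishing error.\<close>
    have "(\<lambda>n. L * (C / sqrt (real n))) \<longlonglongrightarrow> L * 0"
      by (intro tendsto_mult_left tendsto_divide_0[OF tendsto_const]
            filterlim_at_top_imp_at_infinity filterlim_compose[OF sqrt_at_top] filterlim_real_sequentially)
    then have "\<forall>\<^sub>F n in sequentially. L * (C / sqrt (real n)) < \<epsilon>"
      using that by (intro order_tendstoD(2)) auto
    then show "\<forall>\<^sub>F n in sequentially. \<forall>P\<in>\<P>. \<forall>d\<in>space (Pn P n).
        good C P n d \<longrightarrow> \<not> welfare (ghat n d) P - welfare (gstar P) P < - \<epsilon>"
    proof eventually_elim
      case (elim n)
      have "0 \<le> lam / r * max (budget (ghat n d) P - k) 0" for P d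
        using lam r by simp
      note nonneg = this
      show ?case
      proof (intro ballI impI)
        fix P d assume "good C P n d"
        then show "\<not> welfare (ghat n d) P - welfare (gstar P) P < - \<epsilon>"
          using elim nonneg[of d P] unfolding good_def by linarith
      qed
    qed
  qed
  have budget_null: "unif_prob_null \<P> Pn (\<lambda>P n d. \<not> max (budget (ghat n d) P - k) 0
        \<le> r * (welfare (ghat n d) P - welfare (gstar P) P) / lam + \<delta> n)"
    if "exceeds_root_n \<delta>" for \<delta>
  proof (rule null)
    fix C
    have "\<forall>\<^sub>F n in sequentially. r / lam * L * C \<le> sqrt (real n) * \<delta> n"
      using that unfolding exceeds_root_n_def filterlim_at_top by blast
    then show "\<forall>\<^sub>F n in sequentially. \<forall>P\<in>\<P>. \<forall>d\<in>space (Pn P n).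
        good C P n d \<longrightarrow> \<not> \<not> max (budget (ghat n d) P - k) 0
        \<le> r * (welfare (ghat n d) P - welfare (gstar P) P) / lam + \<delta> n"
      using eventually_gt_at_top[of "0::nat"]
    proof eventually_elim
      case (elim n)
      \<comment> \<open>This is where a slack of larger order than the root-n error enters:
        \<open>sqrt n * \<delta> n\<close> eventually passes the constant
        \<open>r / lam * L * C\<close>, whatever \<open>C\<close> is.\<close>
      have \<delta>: "r / lam * (L * (C / sqrt (real n))) \<le> \<delta> n"
      proof -
        have "r / lam * L * C / sqrt (real n) \<le> \<delta> n"
          using elim by (subst pos_divide_le_eq) (simp_all only: mult.commute[of "\<delta> n"], simp)
        then show ?thesis by (simp add: mult.assoc)
      qed
      show ?case
      proof (intro ballI impI)
        fix P d assume "good C P n d"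
        then have "r / lam * (lam / r * max (budget (ghat n d) P - k) 0)
            \<le> r / lam * (welfare (ghat n d) P - welfare (gstar P) P + L * (C / sqrt (real n)))"
          unfolding good_def using lam r by (intro mult_left_mono) auto
        also have "\<dots> \<le> r / lam * (welfare (ghat n d) P - welfare (gstar P) P) + \<delta> n"
          using \<delta> by (simp add: distrib_left)
        finally show "\<not> \<not> max (budget (ghat n d) P - k) 0
            \<le> r * (welfare (ghat n d) P - welfare (gstar P) P) / lam + \<delta> n"
          using lam r by simp
      qed
    qed
  qed
  show ?thesis
    using welfare_null budget_null unfolding unif_prob_null_def by blast
qed

end
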